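(* There is a subgroup $G\subset \mathrm{Diff}^1_+([0,1])$ which is $C^1$-close to the identity and isomorphic to the free group $\mathbb F_2$ on two generators.
   Context: A group $G\subset \mathrm{Diff}^1_+([0,1])$ is $C^1$-close to the identity if there is a sequence $h_n\in \mathrm{Diff}^1_+([0,1])$ such that $h_n g h_n^{-1}\to \mathrm{id}$ in the $C^1$-topology as $n\to\infty$, for every $g\in G$. *)

theory Defs
  imports "HOL-Analysis.Analysis" "HOL-Algebra.Group"
begin

text \<open>A map f : [0,1] -> [0,1] is represented by a function real => real which is
  the identity outside [0,1] (canonical representative), so that composition and
  inverse of such functions correspond to composition and inverse of the
  diffeomorphisms of [0,1].\<close>

definition C1_on_unit :: "(real \<Rightarrow> real) \<Rightarrow> bool" where
  "C1_on_unit f \<longleftrightarrow> (\<exists>f'. continuous_on {0..1} f' \<and>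
      (\<forall>x\<in>{0..1}. (f has_real_derivative f' x) (at x within {0..1})))"

definition Diff1_plus :: "(real \<Rightarrow> real) set" where
  "Diff1_plus = {f. (\<forall>x. x \<notin> {0..1} \<longrightarrow> f x = x)
      \<and> bij_betw f {0..1} {0..1}
      \<and> C1_on_unit f
      \<and> C1_on_unit (inv_into {0..1} f)
      \<and> mono_on {0..1} f}"

definition D01 :: "(real \<Rightarrow> real) \<Rightarrow> real \<Rightarrow> real" where
  "D01 f x = vector_derivative f (at x within {0..1})"

definition C1_tendsto :: "(nat \<Rightarrow> real \<Rightarrow> real) \<Rightarrow> (real \<Rightarrow> real) \<Rightarrow> bool" where
  "C1_tendsto F g \<longleftrightarrow> (\<forall>e>0. \<forall>\<^sub>F n in sequentially. \<forall>x\<in>{0..1}.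
      \<bar>F n x - g x\<bar> < e \<and> \<bar>D01 (F n) x - D01 g x\<bar> < e)"

definition subgroup_Diff1 :: "(real \<Rightarrow> real) set \<Rightarrow> bool" where
  "subgroup_Diff1 G \<longleftrightarrow> G \<subseteq> Diff1_plus \<and> id \<in> G
      \<and> (\<forall>f\<in>G. \<forall>g\<in>G. f \<circ> g \<in> G) \<and> (\<forall>f\<in>G. inv_into UNIV f \<in> G)"

definition diff_group :: "(real \<Rightarrow> real) set \<Rightarrow> (real \<Rightarrow> real) monoid" where
  "diff_group G = \<lparr>carrier = G, mult = (\<circ>), one = id\<rparr>"

definition C1_close_to_id :: "(real \<Rightarrow> real) set \<Rightarrow> bool" where
  "C1_close_to_id G \<longleftrightarrow> (\<exists>h :: nat \<Rightarrow> real \<Rightarrow> real. (\<forall>n. h n \<in> Diff1_plus) \<and>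
      (\<forall>g\<in>G. C1_tendsto (\<lambda>n. h n \<circ> g \<circ> inv_into UNIV (h n)) id))"

text \<open>Letters: (generator index, is_inverse). Elements: freely reduced words.\<close>
type_synonym letter2 = "bool \<times> bool"

definition cancels :: "letter2 \<Rightarrow> letter2 \<Rightarrow> bool" where
  "cancels x y \<longleftrightarrow> fst x = fst y \<and> snd x \<noteq> snd y"

fun red :: "letter2 list \<Rightarrow> letter2 list" where
  "red [] = []"
| "red (x # xs) = (case red xs of [] \<Rightarrow> [x]
      | y # ys \<Rightarrow> (if cancels x y then ys else x # y # ys))"

definition reduced :: "letter2 list \<Rightarrow> bool" where
  "reduced xs \<longleftrightarrow> (\<forall>i. Suc i < length xs \<longrightarrow> \<not> cancels (xs ! i) (xs ! Suc i))"

definition F2 :: "letter2 list monoid" where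
  "F2 = \<lparr>carrier = {xs. reduced xs}, mult = (\<lambda>xs ys. red (xs @ ys)), one = []\<rparr>"

end

theory Submission
  imports Defs "HOL-Library.List_Lenlexorder" "HOL-Real_Asymp.Real_Asymp"
begin

text \<open>
  On integer vectors let the generator a add v_(j-1) to v_j for all odd j, and let b do so for all
  even j > 0. These unipotent maps preserve the lexicographic order, and a reduced word with k
  letters moves some basis vector once the dimension exceeds k + 1, so the free group acts
  faithfully by order automorphisms on the integer lists (ordered by length, then
  lexicographically).

  Blow up every list w to an interval of length l(w), with total length 1, and let the group permute
  these intervals using Yoccoz' equivariant family of diffeomorphisms between intervals. The result
  is of class C^1 as soon as l(g w) / l(w) tends to 1 as w leaves finite sets, and it is C^1-close
  to the identity when this ratio is uniformly close to 1. In dimension d we take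
  l(v) = (c / (B + N(v)))^d with N(v) = v_0^(2^d) + ... + v_(d-1)^2. Since the exponents are halved
  from one coordinate to the next, (B + N(g v)) / (B + N(v)) tends to 1 as N(v) tends to infinity,
  hence is uniformly near 1 if B is large. Changing B for finitely many d does not affect l at
  infinity up to a factor tending to 1, so it amounts to a C^1 conjugacy; the conjugacies h_n let B
  tend to infinity.
\<close>

section \<open>Yoccoz' equivariant family of interval diffeomorphisms\<close>

definition yoccoz :: "real \<Rightarrow> real \<Rightarrow> real" where
  "yoccoz a t = a / pi * (arctan (a * t) + pi / 2)"

text \<open>
  With \<open>\<theta> = \<pi> u / a\<close> and \<open>r = a / b\<close>, the transition map from \<open>(0, a)\<close> to \<open>(0, b)\<close> is
  \<open>b / \<pi> * arctan (r tan \<theta>)\<close>. The addition formula for \<open>arctan (r tan \<theta>) - \<theta>\<close> turns it into an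
  expression that is smooth across \<open>\<theta> = \<pi> / 2\<close>.
\<close>

definition transition :: "real \<Rightarrow> real \<Rightarrow> real \<Rightarrow> real" where
  "transition a b u = (let \<theta> = pi * u / a in
     b / pi * (\<theta> + arctan ((a - b) * sin \<theta> * cos \<theta> / (b * (cos \<theta>)\<^sup>2 + a * (sin \<theta>)\<^sup>2))))"

definition stretch :: "real \<Rightarrow> real \<Rightarrow> real \<Rightarrow> real" where
  "stretch a b u = (if u \<in> {0..a}
     then 1 / ((cos (pi * u / a))\<^sup>2 + (a / b)\<^sup>2 * (sin (pi * u / a))\<^sup>2) - 1 else 0)"

definition displacement :: "real \<Rightarrow> real \<Rightarrow> real \<Rightarrow> real" where
  "displacement a b u = (if u \<le> 0 then 0 else if u \<le> a then transition a b u - u else b - a)"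

lemma yoccoz_pos: "a > 0 \<Longrightarrow> 0 < yoccoz a t"
  using arctan_lbound[of "a * t"] by (simp add: yoccoz_def)

lemma yoccoz_less:
  assumes "a > 0"
  shows "yoccoz a t < a"
proof -
  have "(arctan (a * t) + pi / 2) / pi < 1"
    using arctan_ubound[of "a * t"] by (simp add: divide_simps)
  then have "a * ((arctan (a * t) + pi / 2) / pi) < a * 1"
    using assms by (intro mult_strict_left_mono)
  then show ?thesis
    by (simp add: yoccoz_def)
qed

lemma range_yoccoz:
  assumes "a > 0"
  shows "range (yoccoz a) = {0<..<a}"
proof (intro equalityI subsetI)
  fix u assume "u \<in> {0<..<a}"
  then have "arctan (tan (pi * u / a - pi / 2)) = pi * u / a - pi / 2"
    by (intro arctan_tan) (auto simp: field_simps)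
  then have "yoccoz a (tan (pi * u / a - pi / 2) / a) = u"
    using assms by (simp add: yoccoz_def)
  then show "u \<in> range (yoccoz a)"
    by (metis rangeI)
qed (auto simp: yoccoz_pos yoccoz_less assms)

lemma cos_sin_squares_pos:
  fixes p q x :: real
  assumes "p > 0" "q > 0"
  shows "p * (cos x)\<^sup>2 + q * (sin x)\<^sup>2 > 0"
proof (cases "cos x = 0")
  case True
  then have "(sin x)\<^sup>2 = 1"
    using sin_cos_squared_add[of x] by simp
  then show ?thesis using True assms by simp
qed (use assms in \<open>simp add: add_pos_nonneg\<close>)

lemma arctan_diff:
  assumes "x * y \<ge> 0"
  shows "arctan x - arctan y = arctan ((x - y) / (1 + x * y))"
proof -
  have "\<bar>arctan x + arctan (- y)\<bar> < pi / 2"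
    using assms arctan_bounded[of x] arctan_bounded[of y] zero_le_arctan_iff[of x]
      zero_le_arctan_iff[of y] arctan_le_zero_iff[of x] arctan_le_zero_iff[of y]
    unfolding arctan_minus zero_le_mult_iff abs_less_iff by linarith
  then show ?thesis
    using arctan_add_raw[of x "- y"] by (simp add: arctan_minus)
qed

lemma transition_yoccoz:
  assumes "a > 0" "b > 0"
  shows "transition a b (yoccoz a t) = yoccoz b t"
proof -
  define x where "x = a * t"
  have \<theta>: "pi * yoccoz a t / a = arctan x + pi / 2"
    using assms by (simp add: yoccoz_def x_def)
  have "b * x\<^sup>2 + a = a * (1 + b * t * x)"
    by (simp add: x_def power2_eq_square algebra_simps)
  then have "- ((a - b) * x / (b * x\<^sup>2 + a)) = (b * t - x) / (1 + b * t * x)"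
    using assms by (simp add: x_def divide_simps) (simp add: algebra_simps)
  moreover have "1 + x\<^sup>2 > 0"
    by (intro add_pos_nonneg) auto
  ultimately have "(a - b) * sin (arctan x + pi / 2) * cos (arctan x + pi / 2)
      / (b * (cos (arctan x + pi / 2))\<^sup>2 + a * (sin (arctan x + pi / 2))\<^sup>2)
      = (b * t - x) / (1 + b * t * x)"
    by (simp add: sin_add cos_add sin_arctan cos_arctan power_divide flip: add_divide_distrib)
  also have "arctan \<dots> = arctan (b * t) - arctan x"
    using assms by (intro arctan_diff[symmetric]) (auto simp: x_def zero_le_mult_iff mult_le_0_iff)
  finally show ?thesis
    by (simp add: transition_def yoccoz_def[of b] \<theta> Let_def)
qed

lemma arctan_twist_deriv:
  fixes p q x :: real
  assumes "p > 0" "q > 0"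
  shows "((\<lambda>x. x + arctan ((q - p) * sin x * cos x / (p * (cos x)\<^sup>2 + q * (sin x)\<^sup>2)))
    has_real_derivative p * q / (p\<^sup>2 * (cos x)\<^sup>2 + q\<^sup>2 * (sin x)\<^sup>2)) (at x)"
proof -
  let ?s = "sin x" and ?c = "cos x"
  define D where "D = p * ?c\<^sup>2 + q * ?s\<^sup>2"
  define E where "E = p\<^sup>2 * ?c\<^sup>2 + q\<^sup>2 * ?s\<^sup>2"
  define r where "r x = (q - p) * sin x * cos x / (p * (cos x)\<^sup>2 + q * (sin x)\<^sup>2)" for x
  define r' where "r' = (q - p) * (p * ?c\<^sup>2 - q * ?s\<^sup>2) / D\<^sup>2"
  have D: "D > 0" and E: "E > 0"
    unfolding D_def E_def using assms by (auto intro!: cos_sin_squares_pos)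
  have pythagoras: "?s\<^sup>2 + ?c\<^sup>2 = 1"
    by simp
  have "((q - p) * (?c * ?c - ?s * ?s)) * D - ((q - p) * ?s * ?c) * (2 * (q - p) * ?s * ?c)
      = (q - p) * (p * ?c\<^sup>2 - q * ?s\<^sup>2)"
    using pythagoras unfolding D_def by algebra
  then have "(r has_real_derivative r') (at x)"
    unfolding r_def r'_def using D
    by (auto intro!: derivative_eq_intros simp: D_def power2_eq_square algebra_simps)
  then have "((\<lambda>x. x + arctan (r x)) has_real_derivative 1 + inverse (1 + (r x)\<^sup>2) * r') (at x)"
    by (auto intro!: derivative_eq_intros)
  also have "1 + (r x)\<^sup>2 = E / D\<^sup>2"
  proof -
    have "D\<^sup>2 + ((q - p) * ?s * ?c)\<^sup>2 = E"
      using pythagoras unfolding D_def E_def by algebra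
    then show ?thesis
      using D by (simp add: r_def power_divide divide_simps flip: D_def)
  qed
  also have "1 + inverse (E / D\<^sup>2) * r' = (E + (q - p) * (p * ?c\<^sup>2 - q * ?s\<^sup>2)) / E"
    using D E by (simp add: r'_def divide_simps)
  also have "E + (q - p) * (p * ?c\<^sup>2 - q * ?s\<^sup>2) = p * q"
    using pythagoras unfolding E_def by algebra
  finally show ?thesis
    by (simp add: r_def E_def)
qed

lemma transition_deriv:
  assumes "a > 0" "b > 0"
  shows "(transition a b has_real_derivative
    1 / ((cos (pi * u / a))\<^sup>2 + (a / b)\<^sup>2 * (sin (pi * u / a))\<^sup>2)) (at u)"
proof -
  define \<theta> where "\<theta> u = pi * u / a" for u
  define E where "E = b\<^sup>2 * (cos (\<theta> u))\<^sup>2 + a\<^sup>2 * (sin (\<theta> u))\<^sup>2"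
  have E: "E > 0"
    unfolding E_def using assms by (intro cos_sin_squares_pos) auto
  have "(\<theta> has_real_derivative pi / a) (at u)"
    unfolding \<theta>_def using assms by (auto intro!: derivative_eq_intros)
  from DERIV_cmult[OF DERIV_chain2[OF arctan_twist_deriv[OF assms(2,1)] this], of "b / pi"]
  have "(transition a b has_real_derivative b / pi * (b * a / E * (pi / a))) (at u)"
    by (simp add: transition_def[abs_def] Let_def E_def \<theta>_def)
  also have "b / pi * (b * a / E * (pi / a)) = 1 / (E / b\<^sup>2)"
    using assms by (simp add: power2_eq_square)
  also have "E / b\<^sup>2 = (cos (\<theta> u))\<^sup>2 + (a / b)\<^sup>2 * (sin (\<theta> u))\<^sup>2"
    using assms by (simp add: E_def power_divide add_divide_distrib)
  finally show ?thesis
    by (simp add: \<theta>_def)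
qed

lemma transition_self: "a > 0 \<Longrightarrow> transition a b a = b"
  by (simp add: transition_def)

lemma displacement_beyond: "a > 0 \<Longrightarrow> u \<ge> a \<Longrightarrow> displacement a b u = b - a"
  by (auto simp: displacement_def transition_self)

lemma displacement_yoccoz:
  assumes "a > 0" "b > 0"
  shows "displacement a b (yoccoz a t) = yoccoz b t - yoccoz a t"
  using yoccoz_pos[of a t] yoccoz_less[of a t] assms
  by (simp add: displacement_def transition_yoccoz)

lemma stretch_eq_0: "a > 0 \<Longrightarrow> u \<notin> {0<..<a} \<Longrightarrow> stretch a b u = 0"
  by (auto simp: stretch_def not_less le_less)

lemma stretch_refl [simp]: "a > 0 \<Longrightarrow> stretch a a u = 0"
  by (simp add: stretch_def)

lemma stretch_gt_minus_1:
  assumes "a > 0" "b > 0"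
  shows "stretch a b u > -1"
  using cos_sin_squares_pos[of 1 "(a / b)\<^sup>2"] assms by (auto simp: stretch_def)

lemma abs_stretch_le:
  assumes "a > 0" "b > 0"
  shows "\<bar>stretch a b u\<bar> \<le> \<bar>(b / a)\<^sup>2 - 1\<bar>"
proof (cases "u \<in> {0..a}")
  case True
  define s where "s = (sin (pi * u / a))\<^sup>2"
  define q where "q = (b / a)\<^sup>2"
  have q: "q > 0" "(a / b)\<^sup>2 = 1 / q"
    using assms by (auto simp: q_def power_divide)
  have s: "0 \<le> s" "s \<le> 1" and cos: "(cos (pi * u / a))\<^sup>2 = 1 - s"
    by (auto simp: s_def cos_squared_eq abs_square_le_1)
  have d: "q * (1 - s) + s > 0"
    using cos_sin_squares_pos[of q 1 "pi * u / a"] q by (simp add: cos s_def)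
  have "stretch a b u = 1 / (1 - s + 1 / q * s) - 1"
    using True by (simp add: stretch_def cos q(2) flip: s_def)
  also have "\<dots> = (q - 1) * (s / (q * (1 - s) + s))"
    using d q by (simp add: divide_simps) (simp add: algebra_simps)
  finally have "\<bar>stretch a b u\<bar> = \<bar>q - 1\<bar> * \<bar>s / (q * (1 - s) + s)\<bar>"
    by (simp only: abs_mult)
  also have "\<dots> \<le> \<bar>q - 1\<bar> * 1"
    using d s q by (intro mult_left_mono) (auto simp: divide_simps)
  finally show ?thesis by (simp add: q_def)
qed (auto simp: stretch_def)

lemma continuous_on_stretch:
  assumes "a > 0" "b > 0"
  shows "continuous_on S (stretch a b)"
proof -
  let ?f = "\<lambda>u. 1 / ((cos (pi * u / a))\<^sup>2 + (a / b)\<^sup>2 * (sin (pi * u / a))\<^sup>2) - 1"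
  have "continuous_on S ?f" for S
    using cos_sin_squares_pos[of 1 "(a / b)\<^sup>2"] assms
    by (intro continuous_intros) (auto simp: less_imp_neq[symmetric])
  then have "continuous_on ({0..a} \<union> ({..0} \<union> {a..})) (\<lambda>u. if u \<in> {0..a} then ?f u else 0)"
    using assms by (intro continuous_on_If) auto
  then show ?thesis
    unfolding stretch_def[abs_def] by (rule continuous_on_subset) auto
qed

lemma has_integral_stretch_inside:
  assumes "a > 0" "b > 0" "0 \<le> u" "u \<le> a"
  shows "(stretch a b has_integral transition a b u - u) {0..u}"
proof -
  have "((\<lambda>v. transition a b v - v) has_real_derivative stretch a b v) (at v within {0..u})"
    if "v \<in> {0..u}" for v
    using DERIV_diff[OF DERIV_subset[OF transition_deriv[OF assms(1,2)]] DERIV_ident] that \<open>u \<le> a\<close>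
    by (simp add: stretch_def)
  from fundamental_theorem_of_calculus[OF \<open>0 \<le> u\<close>
      this[unfolded has_real_derivative_iff_has_vector_derivative]]
  show ?thesis
    by (simp add: transition_def)
qed

lemma has_integral_stretch:
  assumes "a > 0" "b > 0"
  shows "(stretch a b has_integral displacement a b u) {0..u}"
proof -
  consider "u \<le> 0" | "0 < u" "u \<le> a" | "a < u"
    by linarith
  then show ?thesis
  proof cases
    case 1
    then show ?thesis
      by (cases "u = 0") (auto simp: displacement_def)
  next
    case 2
    then show ?thesis
      using has_integral_stretch_inside[OF assms, of u] by (simp add: displacement_def)
  next
    case 3
    have "(stretch a b has_integral b - a) {0..a}"
      using has_integral_stretch_inside[OF assms, of a] assms by (simp add: transition_self)
    then have "(stretch a b has_integral b - a) {0..u}"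
      by (rule has_integral_on_superset) (use 3 in \<open>auto simp: stretch_def\<close>)
    then show ?thesis
      using 3 assms by (simp add: displacement_def)
  qed
qed

lemma has_integral_stretch_shift:
  assumes "a > 0" "b > 0" "p \<ge> 0"
  shows "((\<lambda>y. stretch a b (y - p)) has_integral displacement a b (x - p)) {0..x}"
proof -
  have before: "(stretch a b has_integral 0) {- p..v}" if "v \<le> 0" for v
    using that assms by (intro has_integral_is_0) (auto simp: stretch_eq_0)
  have "(stretch a b has_integral displacement a b (x - p)) {- p..x - p}"
  proof (cases "x \<le> p")
    case True
    then show ?thesis
      using before[of "x - p"] by (simp add: displacement_def)
  next
    case False
    then show ?thesis
      using has_integral_combine[OF _ _ before[OF order_refl] has_integral_stretch[OF assms(1,2)]]
        assms(3)
      by simp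
  qed
  then show ?thesis
    using has_integral_shift_real_ivl[of "stretch a b" _ "- p" "x - p" "- p"] by simp
qed

section \<open>Blowing up a linear order\<close>

lemma has_sum_single:
  fixes f :: "'i \<Rightarrow> 'b::{comm_monoid_add,topological_space}"
  assumes "\<And>i. i \<noteq> k \<Longrightarrow> f i = 0"
  shows "(f has_sum f k) UNIV"
  using assms by (intro has_sum_finite_neutralI[of "{k}"]) auto

lemma uniform_limit_infsum_disjoint_supports:
  fixes f :: "'i \<Rightarrow> 'a \<Rightarrow> 'b::real_normed_vector"
  assumes disjoint: "\<And>i j x. x \<in> S \<Longrightarrow> f i x \<noteq> 0 \<Longrightarrow> f j x \<noteq> 0 \<Longrightarrow> i = j"
    and small: "\<And>e. e > 0 \<Longrightarrow> \<forall>\<^sub>F i in cofinite. \<forall>x\<in>S. norm (f i x) < e"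
  shows "uniform_limit S (\<lambda>I x. \<Sum>i\<in>I. f i x) (\<lambda>x. \<Sum>\<^sub>\<infinity>i. f i x) (finite_subsets_at_top UNIV)"
proof (rule uniform_limitI)
  fix e :: real assume "e > 0"
  define J where "J = {i. \<not> (\<forall>x\<in>S. norm (f i x) < e)}"
  have "dist (\<Sum>i\<in>I. f i x) (\<Sum>\<^sub>\<infinity>i. f i x) < e" if I: "finite I" "J \<subseteq> I" and x: "x \<in> S" for I x
  proof (cases "\<exists>k. f k x \<noteq> 0")
    case True
    then obtain k where k: "f k x \<noteq> 0" by blast
    have other: "f i x = 0" if "i \<noteq> k" for i
      using disjoint[OF x k] that by blast
    have "(\<Sum>\<^sub>\<infinity>i. f i x) = f k x"
      by (intro infsumI has_sum_single other)
    moreover have "(\<Sum>i\<in>I. f i x) = (\<Sum>i\<in>I. if i = k then f k x else 0)"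
      by (intro sum.cong) (auto simp: other)
    moreover have "norm (f k x) < e" if "k \<notin> I"
      using that I(2) x by (auto simp: J_def)
    ultimately show ?thesis
      using \<open>e > 0\<close> I(1) by simp
  qed (use \<open>e > 0\<close> in auto)
  moreover have "finite J"
    using small[OF \<open>e > 0\<close>] by (simp add: eventually_cofinite J_def)
  ultimately show "\<forall>\<^sub>F I in finite_subsets_at_top UNIV. \<forall>x\<in>S. dist (\<Sum>i\<in>I. f i x) (\<Sum>\<^sub>\<infinity>i. f i x) < e"
    unfolding eventually_finite_subsets_at_top by blast
qed

definition length_function :: "('w \<Rightarrow> real) \<Rightarrow> bool" where
  "length_function l \<longleftrightarrow> (\<forall>w. l w > 0) \<and> (l has_sum 1) UNIV"

definition left_end :: "('w::linorder \<Rightarrow> real) \<Rightarrow> 'w \<Rightarrow> real" where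
  "left_end l w = infsum l {..<w}"

definition gap :: "('w::linorder \<Rightarrow> real) \<Rightarrow> 'w \<Rightarrow> real set" where
  "gap l w = {left_end l w<..<left_end l w + l w}"

definition gap_point :: "('w::linorder \<Rightarrow> real) \<Rightarrow> 'w \<Rightarrow> real \<Rightarrow> real" where
  "gap_point l w t = left_end l w + yoccoz (l w) t"

lemma length_function_pos: "length_function l \<Longrightarrow> l w > 0"
  by (simp add: length_function_def)

lemma length_function_nonneg: "length_function l \<Longrightarrow> l w \<ge> 0"
  by (rule less_imp_le[OF length_function_pos])

lemma length_function_summable: "length_function l \<Longrightarrow> l summable_on A"
  by (meson length_function_def subset_UNIV summable_on_def summable_on_subset_banach)

lemma infsum_length_function_mono:
  assumes "length_function l" "A \<subseteq> B"
  shows "infsum l A \<le> infsum l B"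
  using assms by (intro infsum_mono2 length_function_summable length_function_nonneg)

lemma infsum_length_function_UNIV: "length_function l \<Longrightarrow> infsum l UNIV = 1"
  by (auto simp: length_function_def intro: infsumI)

lemma left_end_nonneg: "length_function l \<Longrightarrow> 0 \<le> left_end l w"
  by (simp add: left_end_def infsum_nonneg length_function_nonneg)

lemma right_end_eq:
  assumes "length_function l"
  shows "left_end l w + l w = infsum l {..w}"
proof -
  have "{..w} = insert w {..<w}" by auto
  then show ?thesis
    using infsum_insert[OF length_function_summable[OF assms], of w "{..<w}"]
    by (simp add: left_end_def)
qed

lemma right_end_le_left_end: "length_function l \<Longrightarrow> w < v \<Longrightarrow> left_end l w + l w \<le> left_end l v"
  unfolding right_end_eq unfolding left_end_def by (rule infsum_length_function_mono) auto

lemma right_end_le_1: "length_function l \<Longrightarrow> left_end l w + l w \<le> 1"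
  using infsum_length_function_mono[of l "{..w}" UNIV]
  by (simp add: right_end_eq infsum_length_function_UNIV)

lemma left_end_eq_complement:
  assumes "length_function l"
  shows "left_end l w = 1 - infsum l {w..}"
proof -
  have "infsum l ({..<w} \<union> {w..}) = left_end l w + infsum l {w..}"
    unfolding left_end_def using assms by (intro infsum_Un_disjoint length_function_summable) auto
  moreover have "{..<w} \<union> {w..} = UNIV" by auto
  ultimately show ?thesis
    using assms by (simp add: infsum_length_function_UNIV)
qed

lemma gap_disjoint:
  assumes "length_function l" "x \<in> gap l w" "x \<in> gap l v"
  shows "w = v"
  using right_end_le_left_end[OF assms(1), of w v] right_end_le_left_end[OF assms(1), of v w]
    assms(2,3)
  by (cases w v rule: linorder_cases) (auto simp: gap_def)

lemma gap_subset_unit: "length_function l \<Longrightarrow> gap l w \<subseteq> {0..1}"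
  using left_end_nonneg[of l w] right_end_le_1[of l w] by (auto simp: gap_def)

lemma range_gap_point:
  assumes "length_function l"
  shows "range (gap_point l w) = gap l w"
proof -
  have "x \<in> range (gap_point l w) \<longleftrightarrow> x - left_end l w \<in> range (yoccoz (l w))" for x
    by (auto simp: gap_point_def image_iff algebra_simps)
  then show ?thesis
    unfolding set_eq_iff
    by (simp add: range_yoccoz length_function_pos[OF assms] gap_def algebra_simps)
qed

lemma gap_point_in_gap: "length_function l \<Longrightarrow> gap_point l w t \<in> gap l w"
  using range_gap_point by blast

lemma sum_gaps_left_of:
  assumes l: "length_function l" and "finite W" "c \<ge> 0"
    and left: "\<And>w. w \<in> W \<Longrightarrow> left_end l w + l w \<le> c"
  shows "sum l W \<le> c"
proof (cases "W = {}")
  case False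
  have "sum l W \<le> infsum l {..Max W}"
    using assms
    by (intro finite_sum_le_infsum length_function_summable length_function_nonneg) auto
  also have "\<dots> \<le> c"
    using left[of "Max W"] False \<open>finite W\<close> by (simp add: right_end_eq[OF l])
  finally show ?thesis .
qed (use assms in simp)

lemma sum_gaps_right_of:
  assumes l: "length_function l" and "finite W" "d \<le> 1"
    and right: "\<And>w. w \<in> W \<Longrightarrow> d \<le> left_end l w"
  shows "sum l W \<le> 1 - d"
proof (cases "W = {}")
  case False
  have "sum l W \<le> infsum l {Min W..}"
    using assms
    by (intro finite_sum_le_infsum length_function_summable length_function_nonneg) auto
  also have "\<dots> \<le> 1 - d"
    using right[of "Min W"] False \<open>finite W\<close> by (simp add: left_end_eq_complement[OF l])
  finally show ?thesis .
qed (use assms in simp)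

lemma gaps_meet_interval:
  assumes l: "length_function l" and "0 \<le> c" "c < d" "d \<le> 1"
  shows "\<exists>w. gap l w \<inter> {c<..<d} \<noteq> {}"
proof (rule ccontr)
  assume disjoint: "\<nexists>w. gap l w \<inter> {c<..<d} \<noteq> {}"
  have side: "left_end l w + l w \<le> c \<or> d \<le> left_end l w" for w
  proof (rule ccontr)
    assume "\<not> ?thesis"
    then have "max (left_end l w) c < min (left_end l w + l w) d"
      using length_function_pos[OF l, of w] \<open>c < d\<close> by auto
    then obtain y where "max (left_end l w) c < y" "y < min (left_end l w + l w) d"
      using dense by blast
    then have "y \<in> gap l w \<inter> {c<..<d}"
      by (simp add: gap_def)
    then show False using disjoint by blast
  qed
  have "sum l W \<le> c + (1 - d)" if W: "finite W" for W
  proof -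
    let ?L = "{w. left_end l w + l w \<le> c}"
    have "sum l W = sum l (W \<inter> ?L) + sum l (W - ?L)"
      using W by (rule sum.Int_Diff)
    also have "\<dots> \<le> c + (1 - d)"
      using W assms side by (intro add_mono sum_gaps_left_of sum_gaps_right_of) auto
    finally show ?thesis .
  qed
  then have "1 \<le> c + (1 - d)"
    using l unfolding length_function_def by (blast intro: has_sum_le_finite_sums)
  then show False using \<open>c < d\<close> by simp
qed

lemma closure_gaps:
  assumes l: "length_function l"
  shows "closure (\<Union>w. gap l w) = {0..1}"
proof
  show "closure (\<Union>w. gap l w) \<subseteq> {0..1}"
    by (intro closure_minimal UN_least gap_subset_unit l) simp
  show "{0..1} \<subseteq> closure (\<Union>w. gap l w)"
    unfolding subset_iff closure_approachable
  proof (intro allI impI)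
    fix x e :: real assume "x \<in> {0..1}" "e > 0"
    then obtain w where "gap l w \<inter> {max 0 (x - e)<..<min 1 (x + e)} \<noteq> {}"
      using gaps_meet_interval[OF l, of "max 0 (x - e)" "min 1 (x + e)"] by auto
    then show "\<exists>y\<in>\<Union>w. gap l w. dist y x < e"
      by (force simp: dist_real_def abs_less_iff)
  qed
qed

locale asymptotic_isometry =
  fixes l :: "'w::linorder \<Rightarrow> real" and l' :: "'v::linorder \<Rightarrow> real" and s :: "'w \<Rightarrow> 'v"
  assumes length_source: "length_function l"
    and length_target: "length_function l'"
    and strict_mono: "strict_mono s"
    and surj: "surj s"
    and ratio_tendsto_1: "((\<lambda>w. l' (s w) / l w) \<longlongrightarrow> 1) cofinite"
begin

lemma bij: "bij s"
  using strict_mono surj by (auto simp: bij_def intro: strict_mono_imp_inj_on)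

lemmas length_source_pos = length_function_pos[OF length_source]
lemmas length_target_pos = length_function_pos[OF length_target]

end

lemma filterlim_inj_cofinite:
  assumes "inj s"
  shows "filterlim s cofinite cofinite"
  unfolding filterlim_iff eventually_cofinite
proof (intro allI impI)
  fix P :: "'b \<Rightarrow> bool" assume "finite {x. \<not> P x}"
  then show "finite {x. \<not> P (s x)}"
    using finite_vimageI[OF _ assms, of "{x. \<not> P x}"] by (simp add: vimage_def)
qed

lemma asymptotic_isometry_comp:
  assumes "asymptotic_isometry l l' s" "asymptotic_isometry l' l'' s'"
  shows "asymptotic_isometry l l'' (s' \<circ> s)"
proof -
  interpret s: asymptotic_isometry l l' s by fact
  interpret s': asymptotic_isometry l' l'' s' by fact
  have "((\<lambda>w. l'' (s' (s w)) / l' (s w)) \<longlongrightarrow> 1) cofinite"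
    by (intro filterlim_compose[OF s'.ratio_tendsto_1] filterlim_inj_cofinite bij_is_inj s.bij)
  from tendsto_mult[OF this s.ratio_tendsto_1] have "((\<lambda>w. l'' ((s' \<circ> s) w) / l w) \<longlongrightarrow> 1) cofinite"
    using s.length_target_pos by (simp add: less_imp_neq[symmetric])
  moreover have "strict_mono (s' \<circ> s)"
    using s.strict_mono s'.strict_mono by (simp add: strict_mono_def)
  ultimately show ?thesis
    by (intro asymptotic_isometry.intro s.length_source s'.length_target comp_surj s.surj s'.surj)
qed

lemma asymptotic_isometry_inv:
  assumes "asymptotic_isometry l l' s"
  shows "asymptotic_isometry l' l (inv_into UNIV s)"
proof -
  interpret asymptotic_isometry l l' s by fact
  have s_inv: "s (inv_into UNIV s v) = v" for v
    using surj by (simp add: surj_f_inv_f)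
  have "((\<lambda>v. l' (s (inv_into UNIV s v)) / l (inv_into UNIV s v)) \<longlongrightarrow> 1) cofinite"
    by (intro filterlim_compose[OF ratio_tendsto_1] filterlim_inj_cofinite bij_is_inj
        bij_imp_bij_inv bij)
  from tendsto_inverse[OF this] have "((\<lambda>v. l (inv_into UNIV s v) / l' v) \<longlongrightarrow> 1) cofinite"
    by (simp add: s_inv)
  moreover have "strict_mono (inv_into UNIV s)"
  proof (rule strict_monoI)
    fix u v :: 'b assume "u < v"
    then have "s (inv_into UNIV s u) < s (inv_into UNIV s v)"
      by (simp add: s_inv)
    then show "inv_into UNIV s u < inv_into UNIV s v"
      by (simp add: strict_mono_less[OF strict_mono])
  qed
  ultimately show ?thesis
    by (intro asymptotic_isometry.intro length_source length_target bij_is_surj bij_imp_bij_inv bij)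
qed

lemma asymptotic_isometry_id: "length_function l \<Longrightarrow> asymptotic_isometry l l id"
  by (auto simp: asymptotic_isometry_def strict_mono_def length_function_pos
      less_imp_neq[symmetric])

definition slope :: "('w::linorder \<Rightarrow> real) \<Rightarrow> ('v \<Rightarrow> real) \<Rightarrow> ('w \<Rightarrow> 'v) \<Rightarrow> real \<Rightarrow> real" where
  "slope l l' s x = (\<Sum>\<^sub>\<infinity>w. stretch (l w) (l' (s w)) (x - left_end l w))"

definition blowup :: "('w::linorder \<Rightarrow> real) \<Rightarrow> ('v \<Rightarrow> real) \<Rightarrow> ('w \<Rightarrow> 'v) \<Rightarrow> real \<Rightarrow> real" where
  "blowup l l' s x = x + integral {0..x} (slope l l' s)"

lemma stretch_nonzero_imp_in_gap:
  assumes "length_function l" "stretch (l w) b (x - left_end l w) \<noteq> 0"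
  shows "x \<in> gap l w"
  using stretch_eq_0[OF length_function_pos[OF assms(1)], of "x - left_end l w" w b] assms(2)
  by (auto simp: gap_def algebra_simps)

lemma slope_cases:
  assumes "length_function l"
  obtains "slope l l' s x = 0"
    | w where "slope l l' s x = stretch (l w) (l' (s w)) (x - left_end l w)"
proof (cases "\<exists>w. x \<in> gap l w")
  case True
  then obtain w where w: "x \<in> gap l w" by blast
  have "stretch (l v) (l' (s v)) (x - left_end l v) = 0" if "v \<noteq> w" for v
    using stretch_nonzero_imp_in_gap[OF assms] gap_disjoint[OF assms w] that by blast
  then have "slope l l' s x = stretch (l w) (l' (s w)) (x - left_end l w)"
    unfolding slope_def by (intro infsumI has_sum_single)
  then show ?thesis by (rule that)
next
  case False
  then have "slope l l' s x = 0"
    unfolding slope_def using stretch_nonzero_imp_in_gap[OF assms] by (intro infsum_0) blast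
  then show ?thesis by (rule that)
qed

lemma slope_gt_minus_1:
  assumes "length_function l" "length_function l'"
  shows "slope l l' s x > -1"
proof (cases rule: slope_cases[OF assms(1), of l' s x])
  case (2 w)
  then show ?thesis
    using stretch_gt_minus_1[of "l w" "l' (s w)"] assms by (simp add: length_function_pos)
qed simp

lemma abs_slope_le:
  assumes "length_function l" "length_function l'" "e \<ge> 0" "\<And>w. \<bar>(l' (s w) / l w)\<^sup>2 - 1\<bar> \<le> e"
  shows "\<bar>slope l l' s x\<bar> \<le> e"
proof (cases rule: slope_cases[OF assms(1), of l' s x])
  case (2 w)
  then show ?thesis
    using abs_stretch_le[of "l w" "l' (s w)" "x - left_end l w"] assms(4)[of w] assms(1,2)
    by (simp add: length_function_pos)
qed (use assms in simp)

lemma slope_uniform_limit: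
  assumes "asymptotic_isometry l l' s"
  shows "uniform_limit S (\<lambda>W x. \<Sum>w\<in>W. stretch (l w) (l' (s w)) (x - left_end l w))
    (slope l l' s) (finite_subsets_at_top UNIV)"
  unfolding slope_def[abs_def]
proof (rule uniform_limit_infsum_disjoint_supports)
  interpret asymptotic_isometry l l' s by fact
  show "w = v" if "stretch (l w) (l' (s w)) (x - left_end l w) \<noteq> 0"
    "stretch (l v) (l' (s v)) (x - left_end l v) \<noteq> 0" for w v x
    using that stretch_nonzero_imp_in_gap[OF length_source] gap_disjoint[OF length_source] by blast
  fix e :: real assume "e > 0"
  have "((\<lambda>w. \<bar>(l' (s w) / l w)\<^sup>2 - 1\<bar>) \<longlongrightarrow> \<bar>1\<^sup>2 - 1\<bar>) cofinite"
    by (intro tendsto_intros ratio_tendsto_1)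
  then have "\<forall>\<^sub>F w in cofinite. \<bar>(l' (s w) / l w)\<^sup>2 - 1\<bar> < e"
    by (rule order_tendstoD) (use \<open>e > 0\<close> in simp)
  then show "\<forall>\<^sub>F w in cofinite. \<forall>x\<in>S. norm (stretch (l w) (l' (s w)) (x - left_end l w)) < e"
    by (auto elim!: eventually_mono
        intro!: le_less_trans[OF abs_stretch_le] length_source_pos length_target_pos)
qed

lemma continuous_on_sum_stretch:
  assumes "length_function l" "length_function l'"
  shows "continuous_on S (\<lambda>x. \<Sum>w\<in>W. stretch (l w) (l' (s w)) (x - left_end l w))"
  using assms
  by (intro continuous_on_sum continuous_on_compose2[OF continuous_on_stretch])
    (auto simp: length_function_pos intro: continuous_intros)

lemma continuous_on_slope:
  assumes "asymptotic_isometry l l' s"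
  shows "continuous_on S (slope l l' s)"
  using assms unfolding asymptotic_isometry_def
  by (intro uniform_limit_theorem[OF _ slope_uniform_limit[OF assms]] always_eventually allI
      continuous_on_sum_stretch) auto

lemma blowup_deriv:
  assumes "asymptotic_isometry l l' s" "x \<in> {0..1}"
  shows "(blowup l l' s has_real_derivative 1 + slope l l' s x) (at x within {0..1})"
  unfolding blowup_def[abs_def]
  by (intro DERIV_add DERIV_ident integral_has_real_derivative continuous_on_slope assms)

lemma continuous_on_blowup: "asymptotic_isometry l l' s \<Longrightarrow> continuous_on {0..1} (blowup l l' s)"
  by (rule DERIV_continuous_on) (rule blowup_deriv)

lemma displacement_has_sum:
  assumes "asymptotic_isometry l l' s"
  shows "((\<lambda>w. displacement (l w) (l' (s w)) (x - left_end l w)) has_sum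
    (blowup l l' s x - x)) UNIV"
proof -
  interpret asymptotic_isometry l l' s by fact
  let ?f = "\<lambda>W y. \<Sum>w\<in>W. stretch (l w) (l' (s w)) (y - left_end l w)"
  obtain I J where I: "\<And>W. (?f W has_integral I W) {0..x}"
    and J: "(slope l l' s has_integral J) {0..x}" and lim: "(I \<longlongrightarrow> J) (finite_subsets_at_top UNIV)"
    using uniform_limit_integral[OF slope_uniform_limit[OF assms]
        continuous_on_sum_stretch[OF length_source length_target], where a = 0 and b = x] by auto
  have "I W = (\<Sum>w\<in>W. displacement (l w) (l' (s w)) (x - left_end l w))" if "finite W" for W
    using I[of W] by (rule has_integral_unique)
      (intro has_integral_sum has_integral_stretch_shift that length_source_pos length_target_pos
        left_end_nonneg length_source)
  with lim have "((\<lambda>W. \<Sum>w\<in>W. displacement (l w) (l' (s w)) (x - left_end l w)) \<longlongrightarrow> J)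
      (finite_subsets_at_top UNIV)"
    by (elim Lim_transform_eventually) (auto intro: eventually_finite_subsets_at_top_weakI)
  then show ?thesis
    using J by (simp add: has_sum_def blowup_def integral_unique)
qed

lemma has_sum_diff:
  fixes f g :: "'i \<Rightarrow> 'b::topological_ab_group_add"
  assumes "(f has_sum a) A" "(g has_sum b) A"
  shows "((\<lambda>i. f i - g i) has_sum (a - b)) A"
  using has_sum_add[OF assms(1), of "\<lambda>i. - g i" "- b"] assms(2) by (simp add: has_sum_uminus)

lemma blowup_eq_self:
  assumes "asymptotic_isometry l l' s" "x \<notin> {0<..<1}"
  shows "blowup l l' s x = x"
proof (cases "x \<le> 0")
  case True
  then show ?thesis
    by (cases "x = 0") (auto simp: blowup_def)
next
  case False
  interpret asymptotic_isometry l l' s by fact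
  have "((\<lambda>w. l' (s w)) has_sum 1) UNIV"
    using has_sum_reindex_bij_betw[OF bij, of l' 1] length_target by (simp add: length_function_def)
  then have "((\<lambda>w. l' (s w) - l w) has_sum (1 - 1)) UNIV"
    using length_source by (intro has_sum_diff) (auto simp: length_function_def)
  moreover have "displacement (l w) (l' (s w)) (x - left_end l w) = l' (s w) - l w" for w
    using False assms(2) right_end_le_1[OF length_source, of w] length_source_pos[of w]
    by (auto simp: displacement_beyond)
  ultimately show ?thesis
    using has_sum_unique[OF displacement_has_sum[OF assms(1), of x]] by fastforce
qed

lemma strict_mono_surj_image_lessThan:
  fixes s :: "'w::linorder \<Rightarrow> 'v::linorder"
  assumes "strict_mono s" "surj s"
  shows "s ` {..<w} = {..<s w}"
proof (intro equalityI subsetI)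
  fix v assume v: "v \<in> {..<s w}"
  obtain u where "v = s u" using assms(2) by blast
  then show "v \<in> s ` {..<w}" using v strict_mono_less[OF assms(1)] by auto
qed (use strict_monoD[OF assms(1)] in auto)

lemma blowup_gap_point:
  assumes "asymptotic_isometry l l' s"
  shows "blowup l l' s (gap_point l w t) = gap_point l' (s w) t"
proof -
  interpret asymptotic_isometry l l' s by fact
  let ?x = "gap_point l w t"
  let ?d = "\<lambda>v. displacement (l v) (l' (s v)) (?x - left_end l v)"
  have x: "left_end l w < ?x" "?x < left_end l w + l w"
    using gap_point_in_gap[OF length_source, of w t] by (auto simp: gap_def)
  have "bij_betw s {..<w} {..<s w}"
    using strict_mono_surj_image_lessThan[OF strict_mono surj, of w] bij
    by (metis bij_betw_imageI bij_is_inj inj_on_subset subset_UNIV)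
  from has_sum_reindex_bij_betw[OF this, of l' "left_end l' (s w)"]
  have "((\<lambda>v. l' (s v)) has_sum left_end l' (s w)) {..<w}"
    using has_sum_infsum[OF length_function_summable[OF length_target]] by (simp add: left_end_def)
  then have "((\<lambda>v. l' (s v) - l v) has_sum (left_end l' (s w) - left_end l w)) {..<w}"
    unfolding left_end_def[of l]
    by (intro has_sum_diff has_sum_infsum length_function_summable length_source)
  moreover have "?d v = l' (s v) - l v" if "v < w" for v
    using x right_end_le_left_end[OF length_source that] length_source_pos[of v]
    by (simp add: displacement_def)
  ultimately have before: "(?d has_sum (left_end l' (s w) - left_end l w)) {..<w}"
    by (subst has_sum_cong[where g = "\<lambda>v. l' (s v) - l v"]) auto
  have at: "(?d has_sum (yoccoz (l' (s w)) t - yoccoz (l w) t)) {w}"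
    by (simp add: has_sum_finite_iff gap_point_def displacement_yoccoz
        length_source_pos length_target_pos)
  have after: "(?d has_sum 0) {w<..}"
  proof (rule has_sum_0)
    fix v assume "v \<in> {w<..}"
    then show "?d v = 0"
      using x right_end_le_left_end[OF length_source, of w v] by (simp add: displacement_def)
  qed
  have "(?d has_sum (left_end l' (s w) - left_end l w + (yoccoz (l' (s w)) t - yoccoz (l w) t) + 0))
      ({..<w} \<union> {w} \<union> {w<..})"
    by (intro has_sum_Un_disjoint before at after) auto
  moreover have "{..<w} \<union> {w} \<union> {w<..} = UNIV" by auto
  ultimately show ?thesis
    using has_sum_unique[OF displacement_has_sum[OF assms, of ?x]]
    by (fastforce simp: gap_point_def)
qed

lemma blowup_gap:
  assumes "asymptotic_isometry l l' s"
  shows "blowup l l' s ` gap l w = gap l' (s w)"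
  using assms unfolding asymptotic_isometry_def
  by (simp add: image_image blowup_gap_point[OF assms] flip: range_gap_point)

lemma blowup_in_unit:
  assumes "asymptotic_isometry l l' s" "x \<in> {0..1}"
  shows "blowup l l' s x \<in> {0..1}"
proof -
  interpret asymptotic_isometry l l' s by fact
  have "blowup l l' s ` closure (\<Union>w. gap l w) \<subseteq> {0..1}"
  proof (rule image_closure_subset)
    show "continuous_on (closure (\<Union>w. gap l w)) (blowup l l' s)"
      using continuous_on_blowup[OF assms(1)] closure_gaps[OF length_source] by simp
    show "blowup l l' s ` (\<Union>w. gap l w) \<subseteq> {0..1}"
      unfolding image_UN blowup_gap[OF assms(1)] by (intro UN_least gap_subset_unit length_target)
  qed simp
  then show ?thesis using assms(2) closure_gaps[OF length_source] by blast
qed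

lemma blowup_comp:
  assumes "asymptotic_isometry l l' s" "asymptotic_isometry l' l'' s'"
  shows "blowup l' l'' s' \<circ> blowup l l' s = blowup l l'' (s' \<circ> s)"
proof
  fix x
  note comp = asymptotic_isometry_comp[OF assms]
  have l: "length_function l"
    using assms(1) by (rule asymptotic_isometry.length_source)
  let ?d = "\<lambda>x. blowup l' l'' s' (blowup l l' s x) - blowup l l'' (s' \<circ> s) x"
  show "(blowup l' l'' s' \<circ> blowup l l' s) x = blowup l l'' (s' \<circ> s) x"
  proof (cases "x \<in> {0..1}")
    case True
    have "?d x = 0"
    proof (rule continuous_constant_on_closure[where f = ?d])
      show "continuous_on (closure (\<Union>w. gap l w)) ?d"
        unfolding closure_gaps[OF l]
        by (intro continuous_on_diff continuous_on_blowup comp assms(1)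
            continuous_on_compose2[OF continuous_on_blowup[OF assms(2)]])
          (use blowup_in_unit[OF assms(1)] in blast)
      show "x \<in> closure (\<Union>w. gap l w)" using True closure_gaps[OF l] by simp
      fix y assume "y \<in> (\<Union>w. gap l w)"
      then obtain w t where "y = gap_point l w t"
        by (auto simp flip: range_gap_point[OF l])
      then show "?d y = 0"
        by (simp add: blowup_gap_point[OF assms(1)] blowup_gap_point[OF assms(2)]
            blowup_gap_point[OF comp])
    qed
    then show ?thesis by simp
  next
    case False
    then have "x \<notin> {0<..<1}" by auto
    then show ?thesis
      by (simp add: blowup_eq_self[OF assms(1)] blowup_eq_self[OF assms(2)] blowup_eq_self[OF comp])
  qed
qed

lemma blowup_id:
  assumes "length_function l"
  shows "blowup l l id = id"
proof -
  have "slope l l id = (\<lambda>x. 0)"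
    by (simp add: slope_def[abs_def] length_function_pos[OF assms])
  then show ?thesis
    by (simp add: blowup_def[abs_def] id_def)
qed

lemma blowup_inv_comp:
  assumes "asymptotic_isometry l l' s"
  shows "blowup l' l (inv_into UNIV s) \<circ> blowup l l' s = id"
    and "blowup l l' s \<circ> blowup l' l (inv_into UNIV s) = id"
proof -
  interpret asymptotic_isometry l l' s by fact
  note inverse = asymptotic_isometry_inv[OF assms]
  show "blowup l' l (inv_into UNIV s) \<circ> blowup l l' s = id"
    by (simp add: blowup_comp[OF assms inverse] bij_is_inj[OF bij] blowup_id[OF length_source])
  have "s \<circ> inv_into UNIV s = id"
    using surj by (simp add: surj_iff)
  then show "blowup l l' s \<circ> blowup l' l (inv_into UNIV s) = id"
    by (simp add: blowup_comp[OF inverse assms] blowup_id[OF length_target])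
qed

lemma inv_blowup:
  "asymptotic_isometry l l' s \<Longrightarrow> inv_into UNIV (blowup l l' s) = blowup l' l (inv_into UNIV s)"
  by (intro inv_unique_comp blowup_inv_comp)

lemma C1_on_unit_blowup: "asymptotic_isometry l l' s \<Longrightarrow> C1_on_unit (blowup l l' s)"
  unfolding C1_on_unit_def
  by (intro exI[of _ "\<lambda>x. 1 + slope l l' s x"] conjI ballI blowup_deriv continuous_intros
      continuous_on_slope)

lemma C1_on_unit_cong:
  assumes "C1_on_unit f" "\<And>x. x \<in> {0..1} \<Longrightarrow> f x = g x"
  shows "C1_on_unit g"
  using assms has_field_derivative_transform_within[OF _ zero_less_one, of f _ _ "{0..1}" g]
  unfolding C1_on_unit_def by blast

lemma mono_on_blowup:
  assumes "asymptotic_isometry l l' s"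
  shows "mono_on {0..1} (blowup l l' s)"
proof (rule mono_onI)
  fix x y :: real assume xy: "x \<in> {0..1}" "y \<in> {0..1}" "x \<le> y"
  have "(blowup l l' s has_real_derivative 1 + slope l l' s z) (at z within {x..y})"
    if "x \<le> z" "z \<le> y" for z
    using that xy by (intro DERIV_subset[OF blowup_deriv[OF assms]]) auto
  then obtain z where "blowup l l' s y - blowup l l' s x = (1 + slope l l' s z) * (y - x)"
    using mvt_very_simple[OF xy(3), of "blowup l l' s" "\<lambda>z h. (1 + slope l l' s z) * h"]
    unfolding has_field_derivative_def by blast
  moreover have "1 + slope l l' s z \<ge> 0"
    using slope_gt_minus_1[of l l' s z] assms by (simp add: asymptotic_isometry_def)
  ultimately show "blowup l l' s x \<le> blowup l l' s y"
    using xy by (metis diff_ge_0_iff_ge mult_nonneg_nonneg)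
qed

lemma blowup_in_Diff1_plus:
  assumes "asymptotic_isometry l l' s"
  shows "blowup l l' s \<in> Diff1_plus"
proof -
  let ?f = "blowup l l' s" and ?g = "blowup l' l (inv_into UNIV s)"
  note s' = asymptotic_isometry_inv[OF assms]
  have gf: "?g (?f x) = x" and fg: "?f (?g x) = x" for x
    using blowup_inv_comp[OF assms] by (metis comp_apply id_apply)+
  have bij: "bij_betw ?f {0..1} {0..1}"
    by (rule bij_betw_byWitness[where f' = ?g])
      (use gf fg blowup_in_unit[OF assms] blowup_in_unit[OF s'] in auto)
  then have "?g x = inv_into {0..1} ?f x" if "x \<in> {0..1}" for x
    using that fg blowup_in_unit[OF s' that] by (metis bij_betw_def inv_into_f_f)
  then have "C1_on_unit (inv_into {0..1} ?f)"
    by (rule C1_on_unit_cong[OF C1_on_unit_blowup[OF s']])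
  then show ?thesis
    using bij C1_on_unit_blowup[OF assms] mono_on_blowup[OF assms] blowup_eq_self[OF assms]
    by (auto simp: Diff1_plus_def)
qed

lemma D01_eqI:
  assumes "(f has_real_derivative d) (at x within {0..1})" "x \<in> {0..1}"
  shows "D01 f x = d"
  unfolding D01_def using assms
  by (intro vector_derivative_within_cbox[of 0 1, unfolded cbox_interval])
     (auto simp: has_real_derivative_iff_has_vector_derivative)

lemma blowup_C1_close_to_id:
  assumes isometry: "asymptotic_isometry l l' s"
    and "e \<ge> 0" and ratio: "\<And>w. \<bar>(l' (s w) / l w)\<^sup>2 - 1\<bar> \<le> e" and x: "x \<in> {0..1}"
  shows "\<bar>blowup l l' s x - x\<bar> \<le> e" "\<bar>D01 (blowup l l' s) x - 1\<bar> \<le> e"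
proof -
  have slope: "\<bar>slope l l' s y\<bar> \<le> e" for y
    using isometry unfolding asymptotic_isometry_def by (intro abs_slope_le \<open>e \<ge> 0\<close> ratio) auto
  have "\<bar>integral {0..x} (slope l l' s)\<bar> \<le> e * (x - 0)"
    using integral_bound[of 0 x "slope l l' s" e] continuous_on_slope[OF isometry] slope x by simp
  also have "\<dots> \<le> e"
    using x \<open>e \<ge> 0\<close> by (simp add: mult_left_le)
  finally show "\<bar>blowup l l' s x - x\<bar> \<le> e"
    by (simp add: blowup_def)
  have "D01 (blowup l l' s) x = 1 + slope l l' s x"
    by (intro D01_eqI blowup_deriv isometry x)
  then show "\<bar>D01 (blowup l l' s) x - 1\<bar> \<le> e"
    using slope by simp
qed

lemma blowup_C1_tendsto_id:
  assumes isometry: "\<And>n. asymptotic_isometry (l n) (l' n) (s n)"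
    and ratio: "uniform_limit UNIV (\<lambda>n w. l' n (s n w) / l n w) (\<lambda>w. 1) sequentially"
  shows "C1_tendsto (\<lambda>n. blowup (l n) (l' n) (s n)) id"
  unfolding C1_tendsto_def
proof (intro allI impI)
  fix e :: real assume "e > 0"
  have D01_id: "D01 id x = 1" if "x \<in> {0..1}" for x
    using that by (intro D01_eqI) (auto simp: id_def)
  have "uniform_limit UNIV (\<lambda>n w. (l' n (s n w) / l n w)\<^sup>2) (\<lambda>w. 1) sequentially"
    using bounded_bilinear.bounded_uniform_limit[OF bounded_bilinear_mult ratio ratio]
    by (simp add: power2_eq_square image_constant_conv)
  from uniform_limitD[OF this, of "e / 2"]
  have "\<forall>\<^sub>F n in sequentially. \<forall>w. \<bar>(l' n (s n w) / l n w)\<^sup>2 - 1\<bar> < e / 2"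
    using \<open>e > 0\<close> by (simp add: dist_real_def)
  then show "\<forall>\<^sub>F n in sequentially. \<forall>x\<in>{0..1}. \<bar>blowup (l n) (l' n) (s n) x - id x\<bar> < e
      \<and> \<bar>D01 (blowup (l n) (l' n) (s n)) x - D01 id x\<bar> < e"
  proof eventually_elim
    case (elim n)
    then have "\<bar>(l' n (s n w) / l n w)\<^sup>2 - 1\<bar> \<le> e / 2" for w
      by (simp add: less_imp_le)
    with blowup_C1_close_to_id[OF isometry, of "e / 2" n] show ?case
      using \<open>e > 0\<close> by (auto simp: D01_id intro: le_less_trans[of _ "e / 2"])
  qed
qed

lemma blowup_conj_id:
  assumes "asymptotic_isometry l l' id" "asymptotic_isometry l l s"
  shows "blowup l l' id \<circ> blowup l l s \<circ> inv_into UNIV (blowup l l' id) = blowup l' l' s"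
proof -
  have inverse: "asymptotic_isometry l' l id"
    using asymptotic_isometry_inv[OF assms(1)] by (simp add: inv_id)
  have "blowup l l s \<circ> blowup l' l id = blowup l' l s"
    using blowup_comp[OF inverse assms(2)] by simp
  moreover have "blowup l l' id \<circ> blowup l' l s = blowup l' l' s"
    using blowup_comp[OF asymptotic_isometry_comp[OF inverse assms(2)] assms(1)] by simp
  ultimately show ?thesis
    by (simp add: inv_blowup[OF assms(1)] inv_id comp_assoc)
qed

section \<open>Actions of the free group\<close>

fun inverse_letter :: "letter2 \<Rightarrow> letter2" where
  "inverse_letter (g, i) = (g, \<not> i)"

definition inverse_word :: "letter2 list \<Rightarrow> letter2 list" where
  "inverse_word xs = map inverse_letter (rev xs)"

fun word_map :: "(letter2 \<Rightarrow> 'a \<Rightarrow> 'a) \<Rightarrow> letter2 list \<Rightarrow> 'a \<Rightarrow> 'a" where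
  "word_map act [] = id"
| "word_map act (x # xs) = act x \<circ> word_map act xs"

lemma word_map_append: "word_map act (xs @ ys) = word_map act xs \<circ> word_map act ys"
  by (induction xs) (simp_all add: o_assoc)

lemma inverse_letter_inverse_letter [simp]: "inverse_letter (inverse_letter x) = x"
  by (cases x) simp

lemma inverse_letter_eq_iff [simp]: "inverse_letter x = inverse_letter y \<longleftrightarrow> x = y"
  by (metis inverse_letter_inverse_letter)

lemma cancels_iff: "cancels x y \<longleftrightarrow> x = inverse_letter y"
  by (cases x; cases y) (auto simp: cancels_def)

lemma reduced_iff_successively: "reduced xs \<longleftrightarrow> successively (\<lambda>x y. \<not> cancels x y) xs"
  by (auto simp: reduced_def successively_conv_nth)

lemma reduced_red: "reduced (red xs)"
  by (induction xs) (auto simp: reduced_iff_successively successively_Cons split: list.splits)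

lemma reduced_inverse_word: "reduced xs \<Longrightarrow> reduced (inverse_word xs)"
  unfolding reduced_iff_successively inverse_word_def successively_map successively_rev
  by (erule successively_mono) (auto simp: cancels_iff)

locale F2_action =
  fixes act :: "letter2 \<Rightarrow> 'a \<Rightarrow> 'a"
  assumes act_inverse_letter: "act (inverse_letter x) \<circ> act x = id"
begin

lemma act_inverse_letter': "act x \<circ> act (inverse_letter x) = id"
  using act_inverse_letter[of "inverse_letter x"] by simp

lemma surj_act: "surj (act x)"
  using act_inverse_letter' by (metis surj_def comp_apply id_apply)

lemma word_map_red: "word_map act (red xs) = word_map act xs"
proof (induction xs)
  case (Cons x xs)
  show ?case
  proof (cases "red xs")
    case Nil
    then have "word_map act xs = id"
      using Cons by (metis word_map.simps(1))
    then show ?thesis using Nil by simp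
  next
    case red: (Cons y ys)
    then have word_map_xs: "word_map act xs = act y \<circ> word_map act ys"
      using Cons by (metis word_map.simps(2))
    show ?thesis
    proof (cases "cancels x y")
      case True
      then have "act x \<circ> (act y \<circ> word_map act ys) = word_map act ys"
        by (simp add: cancels_iff o_assoc act_inverse_letter)
      then show ?thesis using red True word_map_xs by simp
    next
      case False
      then show ?thesis using red word_map_xs by simp
    qed
  qed
qed simp

lemma word_map_inverse_word_comp:
  "word_map act (inverse_word xs) \<circ> word_map act xs = id"
  "word_map act xs \<circ> word_map act (inverse_word xs) = id"
proof -
  have "word_map act (inverse_word xs) (word_map act xs v) = v" for v
    using act_inverse_letter
    by (induction xs) (auto simp: inverse_word_def word_map_append fun_eq_iff)
  moreover have "word_map act xs (word_map act (inverse_word xs) v) = v" for v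
    using act_inverse_letter'
    by (induction xs arbitrary: v) (auto simp: inverse_word_def word_map_append fun_eq_iff)
  ultimately show "word_map act (inverse_word xs) \<circ> word_map act xs = id"
    "word_map act xs \<circ> word_map act (inverse_word xs) = id"
    by (auto simp: fun_eq_iff)
qed

lemma inv_word_map: "inv_into UNIV (word_map act xs) = word_map act (inverse_word xs)"
  by (intro inv_unique_comp word_map_inverse_word_comp)

lemma range_word_map: "range (word_map act) = word_map act ` {xs. reduced xs}"
proof (intro equalityI subsetI)
  fix f assume "f \<in> range (word_map act)"
  then obtain xs where "f = word_map act (red xs)"
    by (auto simp: word_map_red)
  then show "f \<in> word_map act ` {xs. reduced xs}"
    by (auto intro: reduced_red)
qed auto

end

locale faithful_F2_action = F2_action +
  assumes faithful: "reduced xs \<Longrightarrow> word_map act xs = id \<Longrightarrow> xs = []"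
begin

lemma word_map_eq_imp_eq:
  assumes "reduced xs" "reduced ys" "word_map act xs = word_map act ys"
  shows "xs = ys"
  using assms
proof (induction xs arbitrary: ys)
  case Nil
  then show ?case using faithful by (metis word_map.simps(1))
next
  case (Cons x xs)
  show ?case
  proof (cases ys)
    case Nil
    then show ?thesis using faithful Cons.prems by (metis word_map.simps(1))
  next
    case ys: (Cons y zs)
    show ?thesis
    proof (cases "x = y")
      case True
      have "act (inverse_letter x) \<circ> (act x \<circ> word_map act xs)
          = act (inverse_letter x) \<circ> (act x \<circ> word_map act zs)"
        using Cons.prems(3) unfolding ys True word_map.simps by (rule arg_cong)
      then have "word_map act xs = word_map act zs"
        by (simp add: o_assoc act_inverse_letter)
      moreover have "reduced xs" "reduced zs"
        using Cons.prems ys by (auto simp: reduced_iff_successively successively_Cons)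
      ultimately show ?thesis using Cons.IH True ys by blast
    next
      case False
      have "reduced (inverse_word (x # xs) @ ys)"
        using reduced_inverse_word[OF Cons.prems(1)] Cons.prems(2) False ys
        by (auto simp: reduced_iff_successively successively_append_iff inverse_word_def
            cancels_iff)
      moreover have "word_map act (inverse_word (x # xs) @ ys) = id"
        unfolding word_map_append Cons.prems(3)[symmetric] by (rule word_map_inverse_word_comp)
      ultimately have "inverse_word (x # xs) @ ys = []"
        by (rule faithful)
      then show ?thesis using ys by simp
    qed
  qed
qed

lemma bij_betw_word_map: "bij_betw (word_map act) {xs. reduced xs} (range (word_map act))"
  unfolding range_word_map by (intro bij_betw_imageI inj_onI) (auto intro: word_map_eq_imp_eq)

end

lemma subgroup_Diff1_range_word_map:
  assumes "F2_action act" "\<And>xs. word_map act xs \<in> Diff1_plus"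
  shows "subgroup_Diff1 (range (word_map act))"
proof -
  interpret F2_action act by fact
  have "id \<in> range (word_map act)"
    by (metis rangeI word_map.simps(1))
  moreover have "word_map act xs \<circ> word_map act ys \<in> range (word_map act)" for xs ys
    by (simp flip: word_map_append)
  ultimately show ?thesis
    using assms(2) by (auto simp: subgroup_Diff1_def inv_word_map)
qed

lemma diff_group_range_word_map_iso_F2:
  assumes "faithful_F2_action act"
  shows "diff_group (range (word_map act)) \<cong> F2"
proof -
  interpret faithful_F2_action act by fact
  let ?G = "range (word_map act)" and ?R = "{xs. reduced xs}"
  define code where "code = inv_into ?R (word_map act)"
  have bij: "bij_betw code ?G ?R"
    unfolding code_def by (rule bij_betw_inv_into[OF bij_betw_word_map])
  have word_map_code: "word_map act (code f) = f" if "f \<in> ?G" for f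
    unfolding code_def using that bij_betw_inv_into_right[OF bij_betw_word_map] by blast
  have "code (f \<circ> g) = red (code f @ code g)" if "f \<in> ?G" "g \<in> ?G" for f g
  proof -
    have "word_map act (red (code f @ code g)) = f \<circ> g"
      using that by (simp add: word_map_red word_map_append word_map_code)
    then show ?thesis
      using bij_betw_inv_into_left[OF bij_betw_word_map, of "red (code f @ code g)"]
      by (simp add: code_def reduced_red)
  qed
  then have "code \<in> iso (diff_group ?G) F2"
    using bij by (auto simp: iso_def hom_def diff_group_def F2_def bij_betw_def)
  then show ?thesis by (rule is_isoI)
qed

section \<open>The shear action on integer lists\<close>

definition letter_sign :: "letter2 \<Rightarrow> int" where
  "letter_sign x = (if snd x then -1 else 1)"

definition shear :: "letter2 \<Rightarrow> int list \<Rightarrow> int list" where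
  "shear x v = map (\<lambda>j. v ! j + (if 0 < j \<and> even j = fst x then letter_sign x * v ! (j - 1) else 0))
     [0..<length v]"

lemma length_shear [simp]: "length (shear x v) = length v"
  by (simp add: shear_def)

lemma nth_shear:
  "j < length v \<Longrightarrow>
    shear x v ! j = v ! j + (if 0 < j \<and> even j = fst x then letter_sign x * v ! (j - 1) else 0)"
  by (simp add: shear_def)

interpretation shear: F2_action shear
proof
  fix x
  have "fst (inverse_letter x) = fst x" "letter_sign (inverse_letter x) = - letter_sign x"
    by (cases x; simp add: letter_sign_def)+
  then show "shear (inverse_letter x) \<circ> shear x = id"
    by (intro ext nth_equalityI) (auto simp: nth_shear)
qed

lemma length_word_map_shear [simp]: "length (word_map shear xs v) = length v"
  by (induction xs) auto

lemma list_less_iff_nth: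
  fixes v w :: "'a::linorder list"
  shows "v < w \<longleftrightarrow> length v < length w \<or>
    length v = length w \<and> (\<exists>k<length v. take k v = take k w \<and> v ! k < w ! k)"
  by (auto simp: list_less_def lenlex_conv lexord_lex lexord_take_index_conv)

lemma strict_mono_shear: "strict_mono (shear x)"
proof (rule strict_monoI)
  fix v w :: "int list"
  assume "v < w"
  then consider "length v < length w"
    | k where "length v = length w" "k < length v" "take k v = take k w" "v ! k < w ! k"
    by (auto simp: list_less_iff_nth)
  then show "shear x v < shear x w"
  proof cases
    case 2
    have nth_eq: "v ! j = w ! j" if "j < k" for j
      using 2(3) that by (metis nth_take)
    have "take k (shear x v) = take k (shear x w)"
      using 2 nth_eq by (intro nth_equalityI) (auto simp: nth_shear)
    moreover have "shear x v ! k < shear x w ! k"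
      using 2 nth_eq[of "k - 1"] by (auto simp: nth_shear)
    ultimately show ?thesis
      using 2 unfolding list_less_iff_nth by auto
  qed (simp add: list_less_iff_nth)
qed

text \<open>
  The invariant behind faithfulness: in a reduced word acting on a basis vector, each new syllable
  moves the last nonzero entry one place to the right, and repeating its letter only increases that
  entry in absolute value.
\<close>

definition frontier :: "letter2 \<Rightarrow> nat \<Rightarrow> int list \<Rightarrow> bool" where
  "frontier x k v \<longleftrightarrow> 0 < k \<and> k < length v \<and> even k = fst x \<and> v ! (k - 1) \<noteq> 0 \<and>
     (\<exists>n>0. v ! k = n * letter_sign x * v ! (k - 1)) \<and> (\<forall>j<length v. k < j \<longrightarrow> v ! j = 0)"

lemma frontier_nth_nonzero: "frontier x k v \<Longrightarrow> v ! k \<noteq> 0"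
  by (auto simp: frontier_def letter_sign_def split: if_splits)

lemma frontier_shear_same:
  assumes "frontier x k v"
  shows "frontier x k (shear x v)"
proof -
  obtain n where n: "n > 0" "v ! k = n * letter_sign x * v ! (k - 1)"
    using assms by (auto simp: frontier_def)
  have "shear x v ! (k - 1) = v ! (k - 1)"
    using assms by (cases k) (auto simp: frontier_def nth_shear)
  moreover have "shear x v ! k = (n + 1) * letter_sign x * v ! (k - 1)"
    using assms n(2) by (auto simp: frontier_def nth_shear algebra_simps)
  moreover have "shear x v ! j = 0" if "j < length v" "k < j" for j
  proof (cases "j = Suc k")
    case False
    then show ?thesis using that assms by (auto simp: frontier_def nth_shear)
  qed (use that assms in \<open>auto simp: frontier_def nth_shear\<close>)
  ultimately show ?thesis
    using assms n(1) by (auto simp: frontier_def intro!: exI[of _ "n + 1"])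
qed

lemma frontier_shear_next:
  assumes "v ! k \<noteq> 0" "\<And>j. j < length v \<Longrightarrow> k < j \<Longrightarrow> v ! j = 0"
    and "even (Suc k) = fst x" "Suc k < length v"
  shows "frontier x (Suc k) (shear x v)"
  using assms by (auto simp: frontier_def nth_shear intro!: exI[of _ 1])

lemma frontier_word_map_shear:
  fixes v :: "int list"
  assumes v: "v ! k0 \<noteq> 0" "\<And>j. j < length v \<Longrightarrow> k0 < j \<Longrightarrow> v ! j = 0"
    and "xs \<noteq> []" "reduced xs" "even (Suc k0) = fst (last xs)" "k0 + length xs < length v"
  shows "\<exists>k. k0 < k \<and> k \<le> k0 + length xs \<and> frontier (hd xs) k (word_map shear xs v)"
  using assms(3-)
proof (induction xs rule: list_nonempty_induct)
  case (single x)
  then show ?case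
    using v by (intro exI[of _ "Suc k0"]) (auto intro!: frontier_shear_next)
next
  case (cons x xs)
  let ?u = "word_map shear xs v"
  have reduced: "reduced xs" "\<not> cancels x (hd xs)"
    using cons.prems cons.hyps by (auto simp: reduced_iff_successively successively_Cons)
  then obtain k where k: "k0 < k" "k \<le> k0 + length xs" and u: "frontier (hd xs) k ?u"
    using cons by auto
  show ?case
  proof (cases "fst x = fst (hd xs)")
    case True
    then have "x = hd xs"
      using reduced(2) by (auto simp: cancels_def prod_eq_iff)
    then show ?thesis
      using frontier_shear_same[OF u] k by auto
  next
    case False
    then have "frontier x (Suc k) (shear x ?u)"
      using u frontier_nth_nonzero[OF u] k cons.prems
      by (intro frontier_shear_next) (auto simp: frontier_def)
    then show ?thesis
      using k by (intro exI[of _ "Suc k"]) auto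
  qed
qed

interpretation shear: faithful_F2_action shear
proof
  fix xs assume reduced: "reduced xs" and id: "word_map shear xs = id"
  show "xs = []"
  proof (rule ccontr)
    assume "xs \<noteq> []"
    define k0 :: nat where "k0 = (if fst (last xs) then 1 else 0)"
    define L where "L = k0 + length xs + 1"
    define v :: "int list" where "v = (replicate L 0)[k0 := 1]"
    have nth_v: "v ! j = (if j = k0 then 1 else 0)" if "j < length v" for j
      using that by (simp add: v_def nth_list_update)
    have "length v = k0 + length xs + 1"
      unfolding v_def length_list_update length_replicate L_def ..
    moreover have "even (Suc k0) = fst (last xs)"
      by (simp add: k0_def)
    ultimately obtain k where k: "k0 < k" "frontier (hd xs) k v"
      using frontier_word_map_shear[of v k0 xs] nth_v reduced \<open>xs \<noteq> []\<close> id by auto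
    then show False
      using nth_v[of k] frontier_nth_nonzero[OF k(2)] by (simp add: frontier_def)
  qed
qed

section \<open>Slowly varying lengths\<close>

lemma power_add_diff_le_small:
  fixes x y e :: real
  assumes "x \<noteq> 0" and small: "\<bar>(1 + y / x) ^ p - 1\<bar> \<le> e"
  shows "\<bar>(x + y) ^ p - x ^ p\<bar> \<le> e * \<bar>x\<bar> ^ p"
proof -
  have "x + y = x * (1 + y / x)"
    using assms(1) by (simp add: distrib_left)
  then have "\<bar>(x + y) ^ p - x ^ p\<bar> = \<bar>x\<bar> ^ p * \<bar>(1 + y / x) ^ p - 1\<bar>"
    by (simp add: power_mult_distrib right_diff_distrib flip: power_abs abs_mult)
  also have "\<dots> \<le> \<bar>x\<bar> ^ p * e"
    using small by (intro mult_left_mono) auto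
  finally show ?thesis by (simp add: mult.commute)
qed

lemma power_add_diff_le_large:
  fixes x y c :: real
  assumes "\<bar>x\<bar> \<le> c * \<bar>y\<bar>"
  shows "\<bar>(x + y) ^ p - x ^ p\<bar> \<le> ((c + 1) ^ p + c ^ p) * \<bar>y\<bar> ^ p"
proof -
  have "\<bar>(x + y) ^ p - x ^ p\<bar> \<le> \<bar>x + y\<bar> ^ p + \<bar>x\<bar> ^ p"
    using abs_triangle_ineq4[of "(x + y) ^ p" "x ^ p"] by (simp add: power_abs)
  also have "\<dots> \<le> ((c + 1) * \<bar>y\<bar>) ^ p + (c * \<bar>y\<bar>) ^ p"
    using assms abs_triangle_ineq[of x y]
    by (intro add_mono power_mono) (simp_all add: distrib_right)
  also have "\<dots> = ((c + 1) ^ p + c ^ p) * \<bar>y\<bar> ^ p"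
    unfolding power_mult_distrib by (simp only: distrib_right)
  finally show ?thesis .
qed

lemma power_add_diff_le:
  fixes e :: real
  assumes "e > 0"
  obtains C where "\<And>x y :: real. \<bar>(x + y) ^ p - x ^ p\<bar> \<le> e * \<bar>x\<bar> ^ p + C * \<bar>y\<bar> ^ p"
proof -
  have "((\<lambda>z::real. (1 + z) ^ p) \<longlongrightarrow> (1 + 0) ^ p) (at 0)"
    by (intro tendsto_intros)
  then obtain d where d: "d > 0" "\<And>z. z \<noteq> 0 \<Longrightarrow> \<bar>z\<bar> < d \<Longrightarrow> \<bar>(1 + z) ^ p - 1\<bar> < e"
    using assms unfolding LIM_def by (auto simp: dist_real_def)
  define C where "C = (1 / d + 1) ^ p + (1 / d) ^ p"
  have "C \<ge> 0"
    using d(1) by (simp add: C_def)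
  have "\<bar>(x + y) ^ p - x ^ p\<bar> \<le> e * \<bar>x\<bar> ^ p + C * \<bar>y\<bar> ^ p" for x y :: real
  proof (cases "\<bar>y\<bar> < d * \<bar>x\<bar>")
    case True
    then have "x \<noteq> 0" by auto
    moreover have "\<bar>(1 + y / x) ^ p - 1\<bar> \<le> e"
      using True d(2)[of "y / x"] \<open>x \<noteq> 0\<close> assms
      by (cases "y = 0") (auto simp: abs_divide pos_divide_less_eq)
    ultimately show ?thesis
      using power_add_diff_le_small \<open>C \<ge> 0\<close> by (intro add_increasing2) auto
  next
    case False
    then have "\<bar>x\<bar> \<le> 1 / d * \<bar>y\<bar>"
      using d(1) by (simp add: field_simps)
    then show ?thesis
      unfolding C_def using power_add_diff_le_large assms by (intro add_increasing) auto
  qed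
  then show ?thesis by (rule that)
qed

lemma even_power_add_diff_le:
  fixes e :: real
  assumes "even p" "e > 0"
  obtains C where "C \<ge> 0" "\<And>x y :: real. \<bar>(x + y) ^ p - x ^ p\<bar> \<le> e * (x ^ p + y ^ (2 * p)) + C"
proof -
  obtain C where C: "\<And>x y :: real. \<bar>(x + y) ^ p - x ^ p\<bar> \<le> e * \<bar>x\<bar> ^ p + C * \<bar>y\<bar> ^ p"
    using power_add_diff_le[OF assms(2), where p = p] by blast
  have quadratic: "C * u \<le> e * u\<^sup>2 + C\<^sup>2 / e" for u
  proof -
    have "0 \<le> (e * u - C)\<^sup>2 + e\<^sup>2 * u\<^sup>2 + C\<^sup>2" by simp
    then have "e * (C * u) \<le> e * (e * u\<^sup>2 + C\<^sup>2 / e)"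
      using assms(2) by (simp add: power2_eq_square algebra_simps)
    then show ?thesis
      using assms(2) mult_le_cancel_left_pos by blast
  qed
  have "\<bar>(x + y) ^ p - x ^ p\<bar> \<le> e * (x ^ p + y ^ (2 * p)) + C\<^sup>2 / e" for x y :: real
    using C[of x y] quadratic[of "y ^ p"] assms(1)
    by (simp add: power_even_abs distrib_left flip: power_mult) (simp add: mult.commute)
  then show ?thesis
    using that[of "C\<^sup>2 / e"] assms(2) by simp
qed

text \<open>
  The entry \<open>v ! (j - 1)\<close>, which a shear adds to \<open>v ! j\<close>, has twice the exponent of \<open>v ! j\<close> in the
  height; this leaves room for the growth of \<open>v ! j\<close> under the shear.
\<close>

definition height :: "int list \<Rightarrow> real" where
  "height v = (\<Sum>j<length v. real_of_int (v ! j) ^ (2 ^ (length v - j)))"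

lemma nth_power_nonneg: "j < length v \<Longrightarrow> 0 \<le> real_of_int (v ! j) ^ (2 ^ (length v - j))"
  by (simp add: zero_le_even_power)

lemma height_nonneg: "height v \<ge> 0"
  unfolding height_def by (intro sum_nonneg nth_power_nonneg) simp

lemma nth_power_le_height: "j < length v \<Longrightarrow> real_of_int (v ! j) ^ (2 ^ (length v - j)) \<le> height v"
  unfolding height_def by (intro member_le_sum nth_power_nonneg) auto

lemma power2_le_even_power_int:
  fixes x :: int
  assumes "even n" "n > 0"
  shows "x\<^sup>2 \<le> x ^ n"
proof (cases "x = 0")
  case False
  then have "\<bar>x\<bar> ^ 2 \<le> \<bar>x\<bar> ^ n"
    using assms by (intro power_increasing) (auto elim: evenE)
  then show ?thesis
    using assms(1) by (simp add: power_even_abs)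
qed (use assms in simp)

lemma nth_square_le_height:
  assumes "j < length v"
  shows "(real_of_int (v ! j))\<^sup>2 \<le> height v"
proof -
  have "(v ! j)\<^sup>2 \<le> (v ! j) ^ (2 ^ (length v - j))"
    using assms by (intro power2_le_even_power_int) auto
  then have "(real_of_int (v ! j))\<^sup>2 \<le> real_of_int (v ! j) ^ (2 ^ (length v - j))"
    by (metis of_int_le_iff of_int_power)
  also note nth_power_le_height[OF assms]
  finally show ?thesis .
qed

lemma finite_height_le: "finite {v. length v = d \<and> height v \<le> M}"
proof (rule finite_subset)
  show "{v. length v = d \<and> height v \<le> M} \<subseteq> {v. set v \<subseteq> {-\<lceil>M\<rceil>..\<lceil>M\<rceil>} \<and> length v = d}"
  proof safe
    fix v x assume v: "height v \<le> M" "x \<in> set v"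
    have "\<bar>x\<bar> \<le> x\<^sup>2"
      using self_le_power[of "\<bar>x\<bar>" 2] by (cases "x = 0") auto
    then have "\<bar>real_of_int x\<bar> \<le> (real_of_int x)\<^sup>2"
      by (metis of_int_abs of_int_le_iff of_int_power)
    also have "\<dots> \<le> height v"
      using v(2) nth_square_le_height by (metis in_set_conv_nth)
    finally show "x \<in> {-\<lceil>M\<rceil>..\<lceil>M\<rceil>}"
      using v(1) by (simp, linarith)
  qed
qed (simp add: finite_lists_length_eq)

lemma filterlim_height: "filterlim height at_top (inf cofinite (principal {v. length v = d}))"
  unfolding filterlim_at_top eventually_inf_principal eventually_cofinite
proof
  fix M
  show "finite {v. \<not> (v \<in> {v. length v = d} \<longrightarrow> M \<le> height v)}"
    by (rule finite_subset[OF _ finite_height_le[of d M]]) auto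
qed

lemma shear_nth_power_diff_le:
  assumes "e > 0" "j < d"
  obtains C where "\<And>x v. length v = d \<Longrightarrow>
    \<bar>real_of_int (shear x v ! j) ^ (2 ^ (d - j)) - real_of_int (v ! j) ^ (2 ^ (d - j))\<bar>
      \<le> e * height v + C"
proof -
  let ?p = "2 ^ (d - j) :: nat"
  have "even ?p" "e / 2 > 0"
    using assms by auto
  then obtain C where "C \<ge> 0"
    and C: "\<And>x y :: real. \<bar>(x + y) ^ ?p - x ^ ?p\<bar> \<le> e / 2 * (x ^ ?p + y ^ (2 * ?p)) + C"
    using even_power_add_diff_le by blast
  have "\<bar>real_of_int (shear x v ! j) ^ ?p - real_of_int (v ! j) ^ ?p\<bar> \<le> e * height v + C"
    if v: "length v = d" for x v
  proof (cases "0 < j \<and> even j = fst x")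
    case True
    let ?a = "real_of_int (v ! j)" and ?b = "real_of_int (letter_sign x * v ! (j - 1))"
    have "2 * ?p = 2 ^ (length v - (j - 1))"
      using True \<open>j < d\<close> v by (simp add: Suc_diff_Suc flip: power_Suc)
    moreover have "?b ^ (2 * n) = real_of_int (v ! (j - 1)) ^ (2 * n)" for n
      by (simp add: letter_sign_def)
    ultimately have "?b ^ (2 * ?p) \<le> height v"
      using nth_power_le_height[of "j - 1" v] \<open>j < d\<close> v by (metis less_imp_diff_less)
    then have "e / 2 * (?a ^ ?p + ?b ^ (2 * ?p)) \<le> e / 2 * (height v + height v)"
      using nth_power_le_height[of j v] v assms by (intro mult_left_mono add_mono) auto
    moreover have "\<bar>(?a + ?b) ^ ?p - ?a ^ ?p\<bar> \<le> e / 2 * (?a ^ ?p + ?b ^ (2 * ?p)) + C"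
      by (rule C)
    moreover have "real_of_int (shear x v ! j) = ?a + ?b"
      using True v \<open>j < d\<close> by (simp add: nth_shear)
    ultimately show ?thesis by simp
  next
    case False
    then have "shear x v ! j = v ! j"
      using v \<open>j < d\<close> by (auto simp: nth_shear)
    then show ?thesis
      using \<open>C \<ge> 0\<close> \<open>e > 0\<close> height_nonneg[of v] by simp
  qed
  then show ?thesis by (rule that)
qed

lemma height_shear_diff_le:
  assumes "e > 0"
  obtains K where "\<And>x v. length v = d \<Longrightarrow> \<bar>height (shear x v) - height v\<bar> \<le> e * height v + K"
proof -
  define e' where "e' = e / (real d + 1)"
  have e': "e' > 0" "real d * e' \<le> e"
    using assms by (auto simp: e'_def field_simps)
  have "\<exists>C. \<forall>x v. length v = d \<longrightarrow>
      \<bar>real_of_int (shear x v ! j) ^ (2 ^ (d - j)) - real_of_int (v ! j) ^ (2 ^ (d - j))\<bar>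
      \<le> e' * height v + C"
    if "j < d" for j
    using shear_nth_power_diff_le[OF e'(1) that] by metis
  then obtain C where C: "\<And>j x v. j < d \<Longrightarrow> length v = d \<Longrightarrow>
      \<bar>real_of_int (shear x v ! j) ^ (2 ^ (d - j)) - real_of_int (v ! j) ^ (2 ^ (d - j))\<bar>
      \<le> e' * height v + C j"
    by metis
  have "\<bar>height (shear x v) - height v\<bar> \<le> e * height v + (\<Sum>j<d. C j)" if v: "length v = d" for x v
  proof -
    have "\<bar>height (shear x v) - height v\<bar>
        = \<bar>\<Sum>j<d. real_of_int (shear x v ! j) ^ (2 ^ (d - j)) - real_of_int (v ! j) ^ (2 ^ (d - j))\<bar>"
      by (simp add: height_def v sum_subtractf)
    also have "\<dots> \<le> (\<Sum>j<d. e' * height v + C j)"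
      using C v by (intro order_trans[OF sum_abs] sum_mono) auto
    also have "\<dots> = real d * e' * height v + (\<Sum>j<d. C j)"
      by (simp add: sum.distrib)
    also have "\<dots> \<le> e * height v + (\<Sum>j<d. C j)"
      using e'(2) height_nonneg by (intro add_right_mono mult_right_mono) auto
    finally show ?thesis .
  qed
  then show ?thesis by (rule that)
qed

lemma summable_on_inverse_squares_int: "(\<lambda>x::int. 1 / (1 + (real_of_int x)\<^sup>2)) summable_on UNIV"
proof -
  let ?f = "\<lambda>x::int. 1 / (1 + (real_of_int x)\<^sup>2)"
  have "summable (\<lambda>n. inverse (real n ^ 2))"
    by (rule inverse_power_summable) simp
  then have "summable (\<lambda>n. 1 / (1 + (real n)\<^sup>2))"
  proof (rule summable_comparison_test_ev[rotated])
    show "\<forall>\<^sub>F n in sequentially. norm (1 / (1 + (real n)\<^sup>2)) \<le> inverse (real n ^ 2)"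
      using eventually_gt_at_top[of 0]
      by eventually_elim
        (auto simp: inverse_eq_divide intro!: divide_left_mono mult_pos_pos add_pos_nonneg)
  qed
  then have nat: "(\<lambda>n. 1 / (1 + (real n)\<^sup>2)) summable_on UNIV"
    by (subst summable_on_UNIV_nonneg_real_iff) auto
  have "?f summable_on range int"
    by (subst summable_on_reindex) (use nat in \<open>auto simp: o_def\<close>)
  moreover have "?f summable_on range (\<lambda>n. - int n)"
    by (subst summable_on_reindex) (use nat in \<open>auto simp: o_def inj_def\<close>)
  ultimately have "?f summable_on (range int \<union> range (\<lambda>n. - int n))"
    by (rule summable_on_union)
  moreover have "range int \<union> range (\<lambda>n. - int n) = UNIV"
    by (auto simp: image_iff) (metis int_cases2)
  ultimately show ?thesis by simp
qed

lemma has_sum_prod_list_length: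
  fixes f :: "'a \<Rightarrow> real"
  assumes nonneg: "\<And>x. f x \<ge> 0" and f: "(f has_sum s) UNIV"
  shows "((\<lambda>v. \<Prod>x\<leftarrow>v. f x) has_sum s ^ n) {v. length v = n}"
proof (induction n)
  case 0
  have "{v. length v = 0} = {[] :: 'a list}" by auto
  then show ?case
    by (simp add: has_sum_finite_iff)
next
  case (Suc n)
  let ?P = "\<lambda>v. \<Prod>x\<leftarrow>v. f x"
  have Cons: "bij_betw (\<lambda>(x, v). x # v) (UNIV \<times> {v. length v = n}) {v. length v = Suc n}"
    by (auto simp: bij_betw_def inj_on_def length_Suc_conv image_iff)
  have tail: "((\<lambda>v. f x * ?P v) has_sum (f x * s ^ n)) {v. length v = n}" for x
    by (intro has_sum_cmult_right Suc)
  have head: "((\<lambda>x. f x * s ^ n) has_sum (s * s ^ n)) UNIV"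
    by (intro has_sum_cmult_left f)
  have "(\<lambda>(x, v). f x * ?P v) summable_on (UNIV \<times> {v. length v = n})"
    by (rule summable_on_SigmaI[where g = "\<lambda>x. f x * s ^ n"])
      (use tail has_sum_imp_summable[OF head]
        in \<open>auto intro!: mult_nonneg_nonneg prod_list_nonneg nonneg\<close>)
  then have "((\<lambda>(x, v). f x * ?P v) has_sum (s * s ^ n)) (UNIV \<times> {v. length v = n})"
    using tail by (intro has_sum_SigmaI[OF _ head]) auto
  then show ?case
    using has_sum_reindex_bij_betw[OF Cons, of ?P "s * s ^ n"] by (simp add: case_prod_unfold)
qed

lemma has_sum_prod_list:
  fixes f :: "'a \<Rightarrow> real"
  assumes nonneg: "\<And>x. f x \<ge> 0" and f: "(f has_sum s) UNIV" and "s < 1"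
  shows "((\<lambda>v. \<Prod>x\<leftarrow>v. f x) has_sum (s / (1 - s))) (- {[]})"
proof -
  let ?P = "\<lambda>v. \<Prod>x\<leftarrow>v. f x"
  have "s \<ge> 0"
    using f nonneg by (rule has_sum_nonneg)
  then have geometric: "((\<lambda>n. s ^ n) has_sum (s / (1 - s))) {1..}"
    using \<open>s < 1\<close> by (intro has_sum_geometric_from_1) simp
  have length: "bij_betw snd (SIGMA n:{1..}. {v. length v = n}) (- {[] :: 'a list})"
    by (rule bij_betw_byWitness[where f' = "\<lambda>v. (length v, v)"]) (auto simp: Suc_le_eq)
  have "(\<lambda>(n, v). ?P v) summable_on (SIGMA n:{1..}. {v. length v = n})"
    by (rule summable_on_SigmaI[where g = "\<lambda>n. s ^ n"])
      (use has_sum_prod_list_length[OF nonneg f] has_sum_imp_summable[OF geometric] nonneg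
        in \<open>auto intro!: prod_list_nonneg\<close>)
  then have "((\<lambda>(n, v). ?P v) has_sum (s / (1 - s))) (SIGMA n:{1..}. {v. length v = n})"
    using has_sum_prod_list_length[OF nonneg f] by (intro has_sum_SigmaI[OF _ geometric]) auto
  then show ?thesis
    using has_sum_reindex_bij_betw[OF length, of ?P "s / (1 - s)"] by (simp add: case_prod_unfold)
qed

text \<open>
  The factor 1/3 bounds the total weight of the nonempty lists by 1/3 + 1/9 + ... = 1/2.
\<close>

definition normaliser :: real where
  "normaliser = 1 / (3 * (\<Sum>\<^sub>\<infinity>x::int. 1 / (1 + (real_of_int x)\<^sup>2)))"

definition weight :: "real \<Rightarrow> int list \<Rightarrow> real" where
  "weight B v = (normaliser / (B + height v)) ^ length v"

lemma normaliser_pos: "normaliser > 0"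
proof -
  have "1 = (\<Sum>x\<in>{0::int}. 1 / (1 + (real_of_int x)\<^sup>2))"
    by simp
  also have "\<dots> \<le> (\<Sum>\<^sub>\<infinity>x::int. 1 / (1 + (real_of_int x)\<^sup>2))"
    by (intro finite_sum_le_infsum summable_on_inverse_squares_int) auto
  finally show ?thesis by (simp add: normaliser_def)
qed

lemma has_sum_normaliser: "((\<lambda>x::int. normaliser / (1 + (real_of_int x)\<^sup>2)) has_sum 1 / 3) UNIV"
proof -
  let ?s = "\<Sum>\<^sub>\<infinity>x::int. 1 / (1 + (real_of_int x)\<^sup>2)"
  have "?s \<noteq> 0"
    using normaliser_pos by (auto simp: normaliser_def)
  then have "normaliser * ?s = 1 / 3"
    by (simp add: normaliser_def)
  with has_sum_cmult_right[OF has_sum_infsum[OF summable_on_inverse_squares_int], of normaliser]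
  show ?thesis
    by (simp only: times_divide_eq_right mult_1_right)
qed

lemma weight_pos: "B \<ge> 1 \<Longrightarrow> weight B v > 0"
  using height_nonneg[of v] normaliser_pos by (simp add: weight_def)

lemma weight_le_prod_list:
  assumes "B \<ge> 1"
  shows "weight B v \<le> (\<Prod>x\<leftarrow>v. normaliser / (1 + (real_of_int x)\<^sup>2))"
proof -
  have "weight B v = (\<Prod>j<length v. normaliser / (B + height v))"
    by (simp add: weight_def)
  also have "\<dots> \<le> (\<Prod>j<length v. normaliser / (1 + (real_of_int (v ! j))\<^sup>2))"
  proof (intro prod_mono conjI divide_left_mono)
    show "1 + (real_of_int (v ! j))\<^sup>2 \<le> B + height v" if "j \<in> {..<length v}" for j
      using nth_square_le_height[of j v] that assms by simp
  qed (use normaliser_pos height_nonneg[of v] assms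
      in \<open>auto intro!: divide_nonneg_pos mult_pos_pos add_pos_nonneg\<close>)
  also have "\<dots> = (\<Prod>x\<leftarrow>v. normaliser / (1 + (real_of_int x)\<^sup>2))"
    by (simp add: prod.list_conv_set_nth atLeast0LessThan)
  finally show ?thesis .
qed

lemma weight_sum_le_half:
  assumes "\<And>d. B d \<ge> 1"
  shows "(\<lambda>v. weight (B (length v)) v) summable_on - {[]}"
    and "(\<Sum>\<^sub>\<infinity>v\<in>- {[]}. weight (B (length v)) v) \<le> 1 / 2"
proof -
  have prod: "((\<lambda>v. \<Prod>x\<leftarrow>v. normaliser / (1 + (real_of_int x)\<^sup>2)) has_sum
      (1 / 3) / (1 - 1 / 3)) (- {[]})"
    using normaliser_pos
    by (intro has_sum_prod_list has_sum_normaliser) (auto simp: less_imp_le add_nonneg_nonneg)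
  show summable: "(\<lambda>v. weight (B (length v)) v) summable_on - {[]}"
    by (rule summable_on_comparison_test[OF has_sum_imp_summable[OF prod]])
      (intro weight_le_prod_list less_imp_le[OF weight_pos] assms)+
  have "(\<Sum>\<^sub>\<infinity>v\<in>- {[]}. weight (B (length v)) v) \<le> (1 / 3) / (1 - 1 / 3)"
    by (rule has_sum_mono[OF has_sum_infsum[OF summable] prod]) (rule weight_le_prod_list[OF assms])
  then show "(\<Sum>\<^sub>\<infinity>v\<in>- {[]}. weight (B (length v)) v) \<le> 1 / 2"
    by simp
qed

lemma weight_ratio:
  assumes "B \<ge> 1" "B' \<ge> 1" "length v' = length v"
  shows "weight B' v' / weight B v = inverse ((B' + height v') / (B + height v)) ^ length v"
  using assms height_nonneg[of v] height_nonneg[of v'] normaliser_pos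
  by (simp add: weight_def flip: power_divide)

lemma inverse_power_near_1:
  fixes e :: real
  assumes "e > 0"
  obtains \<delta> where "\<delta> > 0" "\<And>r. \<bar>r - 1\<bar> < \<delta> \<Longrightarrow> \<bar>inverse r ^ n - 1\<bar> < e"
proof -
  have "((\<lambda>r::real. inverse r ^ n) \<longlongrightarrow> inverse 1 ^ n) (at 1)"
    by (intro tendsto_intros) auto
  then obtain \<delta> where \<delta>: "\<delta> > 0" "\<And>r. r \<noteq> 1 \<Longrightarrow> \<bar>r - 1\<bar> < \<delta> \<Longrightarrow> \<bar>inverse r ^ n - 1\<bar> < e"
    using assms unfolding LIM_def by (auto simp: dist_real_def)
  have "\<bar>inverse r ^ n - 1\<bar> < e" if "\<bar>r - 1\<bar> < \<delta>" for r
    using \<delta>(2) that assms by (cases "r = 1") auto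
  with \<delta>(1) show ?thesis by (rule that)
qed

lemma weight_shear_ratio:
  assumes "e > 0"
  obtains M where "\<And>B x v. B \<ge> 1 \<Longrightarrow> length v = d \<Longrightarrow> M \<le> B + height v \<Longrightarrow>
    \<bar>weight B (shear x v) / weight B v - 1\<bar> < e"
proof -
  obtain \<delta> where \<delta>: "\<delta> > 0" "\<And>r. \<bar>r - 1\<bar> < \<delta> \<Longrightarrow> \<bar>inverse r ^ d - 1\<bar> < e"
    using inverse_power_near_1[OF assms] by blast
  obtain K where K: "\<And>x v. length v = d \<Longrightarrow> \<bar>height (shear x v) - height v\<bar> \<le> \<delta> / 3 * height v + K"
    using height_shear_diff_le[of "\<delta> / 3" d] \<delta>(1) by (metis divide_pos_pos zero_less_numeral)
  have "\<bar>weight B (shear x v) / weight B v - 1\<bar> < e"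
    if B: "B \<ge> 1" and v: "length v = d" and large: "3 * K / \<delta> \<le> B + height v" for B x v
  proof -
    define N where "N = B + height v"
    have "N > 0"
      using B height_nonneg[of v] by (simp add: N_def)
    have "\<bar>height (shear x v) - height v\<bar> \<le> \<delta> / 3 * height v + K"
      by (rule K[OF v])
    also have "\<delta> / 3 * height v \<le> \<delta> / 3 * N"
      using B \<delta>(1) by (intro mult_left_mono) (auto simp: N_def)
    also have "K \<le> \<delta> / 3 * N"
      using large \<delta>(1) by (simp add: N_def field_simps)
    also have "\<delta> / 3 * N + \<delta> / 3 * N < \<delta> * N"
      using \<delta>(1) \<open>N > 0\<close> by simp
    finally have "\<bar>(B + height (shear x v)) / (B + height v) - 1\<bar> < \<delta>"
      using \<open>N > 0\<close> by (simp add: N_def abs_divide divide_simps)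
    then show ?thesis
      using \<delta>(2)[of "(B + height (shear x v)) / (B + height v)"]
        weight_ratio[OF B B, of "shear x v" v] v
      by simp
  qed
  then show ?thesis by (rule that)
qed

definition slow_offset :: "real \<Rightarrow> nat \<Rightarrow> real \<Rightarrow> bool" where
  "slow_offset e d B \<longleftrightarrow> B \<ge> 1 \<and>
     (\<forall>x v. length v = d \<longrightarrow> \<bar>weight B (shear x v) / weight B v - 1\<bar> < e)"

lemma slow_offset_ge_1: "slow_offset e d B \<Longrightarrow> B \<ge> 1"
  by (simp add: slow_offset_def)

lemma slow_offset_weight_ratio:
  "slow_offset e (length v) B \<Longrightarrow> \<bar>weight B (shear x v) / weight B v - 1\<bar> < e"
  unfolding slow_offset_def by blast

lemma slow_offset_mono: "slow_offset e d B \<Longrightarrow> e \<le> e' \<Longrightarrow> slow_offset e' d B"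
  by (auto simp: slow_offset_def intro: less_le_trans[of _ e e'])

lemma slow_offset_exists:
  assumes "e > 0"
  shows "\<exists>B. slow_offset e d B"
proof -
  obtain M where M: "\<And>B x v. B \<ge> 1 \<Longrightarrow> length v = d \<Longrightarrow> M \<le> B + height v \<Longrightarrow>
      \<bar>weight B (shear x v) / weight B v - 1\<bar> < e"
    using weight_shear_ratio[OF assms] by blast
  have "M \<le> max 1 M + height v" for v
    using height_nonneg[of v] by simp
  then have "slow_offset e d (max 1 M)"
    using M by (simp add: slow_offset_def)
  then show ?thesis ..
qed

lemma weight_shear_ratio_tendsto_1:
  assumes "B \<ge> 1"
  shows "((\<lambda>v. weight B (shear x v) / weight B v) \<longlongrightarrow> 1) (inf cofinite (principal {v. length v = d}))"
proof (rule tendstoI)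
  fix e :: real assume "e > 0"
  then obtain M where M: "\<And>v. length v = d \<Longrightarrow> M \<le> B + height v \<Longrightarrow>
      \<bar>weight B (shear x v) / weight B v - 1\<bar> < e"
    using weight_shear_ratio assms by metis
  have "\<forall>\<^sub>F v in inf cofinite (principal {v. length v = d}). M - B \<le> height v"
    using filterlim_height by (auto simp: filterlim_at_top)
  then show "\<forall>\<^sub>F v in inf cofinite (principal {v. length v = d}).
      dist (weight B (shear x v) / weight B v) 1 < e"
    unfolding eventually_inf_principal by eventually_elim (auto simp: dist_real_def intro!: M)
qed

lemma weight_offset_ratio_tendsto_1:
  assumes "B \<ge> 1" "B' \<ge> 1"
  shows "((\<lambda>v. weight B' v / weight B v) \<longlongrightarrow> 1) (inf cofinite (principal {v. length v = d}))"
proof -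
  have "((\<lambda>h. (B' + h) / (B + h)) \<longlongrightarrow> 1) at_top"
    by real_asymp
  then have "((\<lambda>v. inverse ((B' + height v) / (B + height v)) ^ d) \<longlongrightarrow> inverse 1 ^ d)
      (inf cofinite (principal {v. length v = d}))"
    by (intro tendsto_intros filterlim_compose[OF _ filterlim_height]) auto
  then have "((\<lambda>v. inverse ((B' + height v) / (B + height v)) ^ d) \<longlongrightarrow> 1)
      (inf cofinite (principal {v. length v = d}))"
    by simp
  then show ?thesis
    by (rule Lim_transform_eventually) (simp add: eventually_inf_principal weight_ratio[OF assms])
qed

lemma tendsto_cofinite_fibrewise:
  fixes f :: "'a \<Rightarrow> 'b::metric_space"
  assumes fibre: "\<And>d::nat. (f \<longlongrightarrow> a) (inf cofinite (principal {x. deg x = d}))"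
    and tail: "\<And>e. e > 0 \<Longrightarrow> \<forall>\<^sub>F d in sequentially. \<forall>x. deg x = d \<longrightarrow> dist (f x) a < e"
  shows "(f \<longlongrightarrow> a) cofinite"
proof (rule tendstoI)
  fix e :: real assume "e > 0"
  then obtain D where D: "\<And>x. deg x \<ge> D \<Longrightarrow> dist (f x) a < e"
    using tail unfolding eventually_sequentially by blast
  have "finite {x. deg x = d \<and> \<not> dist (f x) a < e}" for d
    using tendstoD[OF fibre \<open>e > 0\<close>, of d]
    by (simp add: eventually_inf_principal eventually_cofinite)
  then have "finite (\<Union>d<D. {x. deg x = d \<and> \<not> dist (f x) a < e})"
    by simp
  then have "finite {x. \<not> dist (f x) a < e}"
    by (rule rev_finite_subset) (use D not_less in blast)
  then show "\<forall>\<^sub>F x in cofinite. dist (f x) a < e"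
    by (simp add: eventually_cofinite)
qed

text \<open>
  The empty list is fixed by all shears. Its length absorbs the normalisation, so that the lengths
  of the other lists can be chosen in each dimension independently.
\<close>

definition shear_lengths :: "(nat \<Rightarrow> real) \<Rightarrow> int list \<Rightarrow> real" where
  "shear_lengths B = (\<lambda>v. weight (B (length v)) v)
     ([] := 1 - (\<Sum>\<^sub>\<infinity>v\<in>- {[]}. weight (B (length v)) v))"

lemma length_function_fun_upd:
  assumes pos: "\<And>w. w \<noteq> p \<Longrightarrow> l w > 0" and l: "(l has_sum s) (- {p})" and "s < 1"
  shows "length_function (l(p := 1 - s))"
proof -
  have "(l(p := 1 - s) has_sum s) (- {p})"
    using l by (rule has_sum_cong[THEN iffD1, rotated]) simp
  from has_sum_insert[OF _ this, of p] have "(l(p := 1 - s) has_sum 1) (insert p (- {p}))"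
    by simp
  moreover have "insert p (- {p}) = UNIV" by auto
  ultimately show ?thesis
    using pos \<open>s < 1\<close> by (simp add: length_function_def)
qed

lemma length_function_shear_lengths:
  assumes "\<And>d. B d \<ge> 1"
  shows "length_function (shear_lengths B)"
  unfolding shear_lengths_def
  using weight_sum_le_half[of B] assms
  by (intro length_function_fun_upd has_sum_infsum weight_pos) auto

lemma shear_lengths_ratio:
  assumes "\<And>d. B d \<ge> 1"
  shows "shear_lengths B (shear x v) / shear_lengths B v
    = weight (B (length v)) (shear x v) / weight (B (length v)) v"
proof (cases "v = []")
  case True
  then have "shear x v = v"
    by (simp add: shear_def)
  then show ?thesis
    using length_function_pos[OF length_function_shear_lengths[OF assms], where w = v]
      weight_pos[OF assms, where v = v]
    by (simp add: less_imp_neq[symmetric])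
next
  case False
  then have "shear x v \<noteq> []"
    by (metis length_0_conv length_shear)
  then show ?thesis
    using False by (simp add: shear_lengths_def)
qed

lemma eventually_inverse_Suc_less: "e > 0 \<Longrightarrow> \<forall>\<^sub>F n in sequentially. 1 / (real n + 1) < e"
  by (rule order_tendstoD(2)[of _ 0]) real_asymp

lemma asymptotic_isometry_shear:
  assumes B: "\<And>d. slow_offset (1 / (real d + 1)) d (B d)"
  shows "asymptotic_isometry (shear_lengths B) (shear_lengths B) (shear x)"
proof -
  have B_ge: "B d \<ge> 1" for d
    by (rule slow_offset_ge_1[OF B])
  have "((\<lambda>v. shear_lengths B (shear x v) / shear_lengths B v) \<longlongrightarrow> 1) cofinite"
    unfolding shear_lengths_ratio[OF B_ge]
  proof (rule tendsto_cofinite_fibrewise[where deg = length])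
    fix d
    show "((\<lambda>v. weight (B (length v)) (shear x v) / weight (B (length v)) v) \<longlongrightarrow> 1)
        (inf cofinite (principal {v. length v = d}))"
      using weight_shear_ratio_tendsto_1[OF B_ge[of d], where x = x]
      by (rule Lim_transform_eventually) (simp add: eventually_inf_principal)
  next
    fix e :: real assume "e > 0"
    from eventually_inverse_Suc_less[OF this]
    show "\<forall>\<^sub>F d in sequentially. \<forall>v. length v = d \<longrightarrow>
        dist (weight (B (length v)) (shear x v) / weight (B (length v)) v) 1 < e"
    proof eventually_elim
      case (elim d)
      have "slow_offset e d (B d)"
        using elim by (intro slow_offset_mono[OF B]) simp
      then show ?case
        by (simp add: dist_real_def slow_offset_weight_ratio)
    qed
  qed
  then show ?thesis
    using length_function_shear_lengths[OF B_ge] strict_mono_shear shear.surj_act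
    by (simp add: asymptotic_isometry_def)
qed

lemma asymptotic_isometry_shear_lengths_id:
  assumes "\<And>d. B d \<ge> 1" "\<And>d. B' d \<ge> 1" "\<forall>\<^sub>F d in sequentially. B' d = B d"
  shows "asymptotic_isometry (shear_lengths B) (shear_lengths B') id"
proof -
  have "((\<lambda>v. weight (B' (length v)) v / weight (B (length v)) v) \<longlongrightarrow> 1) cofinite"
  proof (rule tendsto_cofinite_fibrewise[where deg = length])
    fix d
    show "((\<lambda>v. weight (B' (length v)) v / weight (B (length v)) v) \<longlongrightarrow> 1)
        (inf cofinite (principal {v. length v = d}))"
      using weight_offset_ratio_tendsto_1[OF assms(1)[of d] assms(2)[of d]]
      by (rule Lim_transform_eventually) (simp add: eventually_inf_principal)
  next
    fix e :: real assume "e > 0"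
    show "\<forall>\<^sub>F d in sequentially. \<forall>v. length v = d \<longrightarrow>
        dist (weight (B' (length v)) v / weight (B (length v)) v) 1 < e"
      using assms(3)
      by eventually_elim
        (use weight_pos[OF assms(1)] \<open>e > 0\<close> in \<open>simp add: less_imp_neq[symmetric]\<close>)
  qed
  then have "((\<lambda>v. shear_lengths B' (id v) / shear_lengths B v) \<longlongrightarrow> 1) cofinite"
  proof (rule Lim_transform_eventually)
    have "\<forall>\<^sub>F v in cofinite. v \<noteq> ([] :: int list)"
      by (simp add: eventually_cofinite)
    then show "\<forall>\<^sub>F v in cofinite. weight (B' (length v)) v / weight (B (length v)) v
        = shear_lengths B' (id v) / shear_lengths B v"
      by eventually_elim (simp add: shear_lengths_def)
  qed
  then show ?thesis
    using assms(1,2)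
    by (auto simp: asymptotic_isometry_def length_function_shear_lengths strict_mono_def)
qed

lemma shear_lengths_ratio_uniform_limit:
  assumes B: "\<And>n d. slow_offset (1 / (real n + 1)) d (B n d)"
  shows "uniform_limit UNIV (\<lambda>n v. shear_lengths (B n) (shear x v) / shear_lengths (B n) v)
    (\<lambda>v. 1) sequentially"
proof (rule uniform_limitI)
  fix e :: real assume "e > 0"
  have ratio: "shear_lengths (B n) (shear x v) / shear_lengths (B n) v
      = weight (B n (length v)) (shear x v) / weight (B n (length v)) v" for n v
    by (rule shear_lengths_ratio) (rule slow_offset_ge_1[OF B])
  from eventually_inverse_Suc_less[OF \<open>e > 0\<close>]
  show "\<forall>\<^sub>F n in sequentially. \<forall>v\<in>UNIV.
      dist (shear_lengths (B n) (shear x v) / shear_lengths (B n) v) 1 < e"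
  proof eventually_elim
    case (elim n)
    have "slow_offset e d (B n d)" for d
      by (rule slow_offset_mono[OF B less_imp_le[OF elim]])
    then show ?case
      by (simp add: ratio dist_real_def slow_offset_weight_ratio)
  qed
qed

lemma shear_lengths_family_exists:
  obtains l :: "nat \<Rightarrow> int list \<Rightarrow> real"
  where "\<And>n x. asymptotic_isometry (l n) (l n) (shear x)"
    and "\<And>n. asymptotic_isometry (l 0) (l n) id"
    and "\<And>x. uniform_limit UNIV (\<lambda>n v. l n (shear x v) / l n v) (\<lambda>v. 1) sequentially"
proof -
  define \<beta> where "\<beta> d m = (SOME B. slow_offset (1 / (real m + 1)) d B)" for d m :: nat
  have \<beta>: "slow_offset (1 / (real m + 1)) d (\<beta> d m)" for d m
    unfolding \<beta>_def by (rule someI_ex[OF slow_offset_exists]) simp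
  \<comment> \<open>The bound improves as \<open>d\<close> grows, as it does uniformly in \<open>d\<close> as \<open>n\<close> grows, yet
    \<open>B n d\<close> depends on \<open>n\<close> only for the finitely many \<open>d < n\<close>.\<close>
  define B where "B n d = \<beta> d (max d n)" for n d
  have slow: "slow_offset (1 / (real m + 1)) d (B n d)" if "m \<le> max d n" for m n d
  proof -
    have "1 / (real (max d n) + 1) \<le> 1 / (real m + 1)"
      using that by (intro divide_left_mono) auto
    then show ?thesis
      unfolding B_def by (rule slow_offset_mono[OF \<beta>])
  qed
  show ?thesis
  proof (rule that[of "\<lambda>n. shear_lengths (B n)"])
    show "asymptotic_isometry (shear_lengths (B n)) (shear_lengths (B n)) (shear x)" for n x
      by (intro asymptotic_isometry_shear slow) simp
    have "\<forall>\<^sub>F d in sequentially. B n d = B 0 d" for n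
      using eventually_ge_at_top[of n] by eventually_elim (simp add: B_def max_def)
    then show "asymptotic_isometry (shear_lengths (B 0)) (shear_lengths (B n)) id" for n
      unfolding B_def by (intro asymptotic_isometry_shear_lengths_id slow_offset_ge_1[OF \<beta>])
    show "uniform_limit UNIV (\<lambda>n v. shear_lengths (B n) (shear x v) / shear_lengths (B n) v)
        (\<lambda>v. 1) sequentially" for x
      by (intro shear_lengths_ratio_uniform_limit slow) simp
  qed
qed

section \<open>Realising the free group by diffeomorphisms\<close>

lemma asymptotic_isometry_word_map:
  assumes "\<And>x. asymptotic_isometry l l (act x)"
  shows "asymptotic_isometry l l (word_map act xs)"
proof (induction xs)
  case Nil
  show ?case
    using asymptotic_isometry.length_source[OF assms]
    unfolding word_map.simps by (rule asymptotic_isometry_id)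
next
  case (Cons x xs)
  then show ?case
    unfolding word_map.simps by (rule asymptotic_isometry_comp[OF _ assms])
qed

lemma word_map_blowup:
  assumes "\<And>x. asymptotic_isometry l l (act x)"
  shows "word_map (\<lambda>x. blowup l l (act x)) xs = blowup l l (word_map act xs)"
proof (induction xs)
  case Nil
  show ?case
    using blowup_id[OF asymptotic_isometry.length_source[OF assms]] unfolding word_map.simps ..
next
  case (Cons x xs)
  then show ?case
    using blowup_comp[OF asymptotic_isometry_word_map[OF assms] assms]
    by (simp only: word_map.simps)
qed

lemma uniform_limit_word_map_ratio:
  assumes isometry: "\<And>n x. asymptotic_isometry (l n) (l n) (act x)"
    and ratio: "\<And>x. uniform_limit UNIV (\<lambda>n w. l n (act x w) / l n w) (\<lambda>w. 1) sequentially"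
  shows "uniform_limit UNIV (\<lambda>n w. l n (word_map act xs w) / l n w) (\<lambda>w. 1) sequentially"
proof -
  have nonzero: "l n w \<noteq> 0" for n w
    using length_function_pos[OF asymptotic_isometry.length_source[OF isometry]]
    by (simp add: less_imp_neq[symmetric])
  show ?thesis
  proof (induction xs)
    case Nil
    show ?case
      using nonzero by (simp add: uniform_limit_const)
  next
    case (Cons x xs)
    have "uniform_limit UNIV (\<lambda>n w. l n (act x (word_map act xs w)) / l n (word_map act xs w))
        (\<lambda>w. 1) sequentially"
      by (rule uniform_limit_compose'[OF ratio]) simp
    from bounded_bilinear.bounded_uniform_limit[OF bounded_bilinear_mult this Cons]
    show ?case
      using nonzero by (simp add: image_constant_conv)
  qed
qed

lemma gap_point_inject:
  assumes "length_function l" "gap_point l w t = gap_point l v t'"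
  shows "w = v"
  using gap_disjoint[OF assms(1)] gap_point_in_gap[OF assms(1)] assms(2) by metis

lemma blowup_inject:
  assumes "asymptotic_isometry l l' s" "asymptotic_isometry l l' s'"
    and "blowup l l' s = blowup l l' s'"
  shows "s = s'"
proof
  fix w
  have "gap_point l' (s w) 0 = gap_point l' (s' w) 0"
    using assms by (simp flip: blowup_gap_point)
  then show "s w = s' w"
    by (rule gap_point_inject[OF asymptotic_isometry.length_target[OF assms(1)]])
qed

lemma faithful_F2_action_blowup:
  assumes "faithful_F2_action act" and isometry: "\<And>x. asymptotic_isometry l l (act x)"
  shows "faithful_F2_action (\<lambda>x. blowup l l (act x))"
proof -
  interpret faithful_F2_action act by fact
  have length: "length_function l"
    by (rule asymptotic_isometry.length_source[OF isometry])
  show ?thesis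
  proof
    show "blowup l l (act (inverse_letter x)) \<circ> blowup l l (act x) = id" for x
      using blowup_comp[OF isometry[of x] isometry[of "inverse_letter x"]]
      by (simp add: act_inverse_letter blowup_id[OF length])
  next
    fix xs assume "reduced xs" "word_map (\<lambda>x. blowup l l (act x)) xs = id"
    then have "blowup l l (word_map act xs) = blowup l l id"
      by (simp add: word_map_blowup[OF isometry] blowup_id[OF length])
    then have "word_map act xs = id"
      by (rule blowup_inject[OF asymptotic_isometry_word_map asymptotic_isometry_id,
            OF isometry length])
    with \<open>reduced xs\<close> show "xs = []"
      by (rule faithful)
  qed
qed

lemma C1_close_to_id_range_word_map_blowup:
  assumes isometry: "\<And>n x. asymptotic_isometry (l n) (l n) (act x)"
    and change: "\<And>n. asymptotic_isometry (l 0) (l n) id"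
    and ratio: "\<And>x. uniform_limit UNIV (\<lambda>n w. l n (act x w) / l n w) (\<lambda>w. 1) sequentially"
  shows "C1_close_to_id (range (word_map (\<lambda>x. blowup (l 0) (l 0) (act x))))"
  unfolding C1_close_to_id_def
proof (intro exI[of _ "\<lambda>n. blowup (l 0) (l n) id"] conjI allI ballI)
  show "blowup (l 0) (l n) id \<in> Diff1_plus" for n
    by (rule blowup_in_Diff1_plus[OF change])
  fix g assume "g \<in> range (word_map (\<lambda>x. blowup (l 0) (l 0) (act x)))"
  then obtain xs where g: "g = blowup (l 0) (l 0) (word_map act xs)"
    by (auto simp: word_map_blowup[OF isometry])
  have "C1_tendsto (\<lambda>n. blowup (l n) (l n) (word_map act xs)) id"
    by (intro blowup_C1_tendsto_id asymptotic_isometry_word_map uniform_limit_word_map_ratio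
        isometry ratio)
  then show "C1_tendsto (\<lambda>n. blowup (l 0) (l n) id \<circ> g \<circ> inv_into UNIV (blowup (l 0) (l n) id)) id"
    by (simp add: g blowup_conj_id[OF change asymptotic_isometry_word_map[OF isometry]])
qed

theorem theoremt:
  shows "\<exists>G. subgroup_Diff1 G \<and> C1_close_to_id G \<and> diff_group G \<cong> F2"
proof -
  obtain l :: "nat \<Rightarrow> int list \<Rightarrow> real"
    where isometry: "\<And>n x. asymptotic_isometry (l n) (l n) (shear x)"
      and change: "\<And>n. asymptotic_isometry (l 0) (l n) id"
      and ratio: "\<And>x. uniform_limit UNIV (\<lambda>n v. l n (shear x v) / l n v) (\<lambda>v. 1) sequentially"
    using shear_lengths_family_exists by blast
  define act where "act x = blowup (l 0) (l 0) (shear x)" for x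
  have "faithful_F2_action act"
    unfolding act_def
    by (rule faithful_F2_action_blowup[OF shear.faithful_F2_action_axioms isometry])
  then interpret faithful_F2_action act .
  have "word_map act xs \<in> Diff1_plus" for xs
    unfolding act_def word_map_blowup[OF isometry]
    by (intro blowup_in_Diff1_plus asymptotic_isometry_word_map isometry)
  then have "subgroup_Diff1 (range (word_map act))"
    by (rule subgroup_Diff1_range_word_map[OF F2_action_axioms])
  moreover have "C1_close_to_id (range (word_map act))"
    unfolding act_def by (rule C1_close_to_id_range_word_map_blowup[OF isometry change ratio])
  moreover have "diff_group (range (word_map act)) \<cong> F2"
    by (rule diff_group_range_word_map_iso_F2[OF faithful_F2_action_axioms])
  ultimately show ?thesis by blast
qed

end
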